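(* Let $p_h\in W_h$, and let $\bar{\mathbf u}_b\in B_h$ be any function such that $\bar{\mathbf u}_b=Q_b\mathbf g$ on $\partial\Omega$. Let $\bar{\mathbf u}_0$ be the solution of the local problems, on each $T\in\mathcal T_h$, $$a_T(\bar{\mathbf u}_h,\mathbf v)-b_T(\mathbf v,p_h)=(\mathbf f,\mathbf v_0)_T\quad\forall\,\mathbf v=\{\mathbf v_0,\mathbf 0\}\in V_k(T),$$ with $\bar{\mathbf u}_h=\{\bar{\mathbf u}_0,\bar{\mathbf u}_b\}$. Then $(\bar{\mathbf u}_h;p_h)$ is the solution of the weak Galerkin scheme (WG) if and only if $\bar{\mathbf u}_b$ satisfies the operator equation $$S_{\mathbf f}(\bar{\mathbf u}_b;p_h)=\mathbf 0 .$$
   Context: **Problem.** $\Omega\subset\mathbb R^d$, $d\in\{2,3\}$, is a polygonal/polyhedral domain. The schemes discretize the Stokes problem $-\Delta\mathbf u+\nabla p=\mathbf f$, $\nabla\cdot\mathbf u=0$ in $\Omega$, $\mathbf u=\mathbf g$ on $\partial\Omega$, with $\mathbf f\in[L^2(\Omega)]^d$ and Dirichlet datum $\mathbf g$. **Mesh.** $\mathcal T_h$ is a partition of $\Omega$ into polygons ($d=2$) or polyhedra ($d=3$), $\mathcal E_h$ is the set of all edges/flat faces, $\mathcal E_h^0=\mathcal E_h\setminus\partial\Omega$ the interior ones. $h_T$, $h_e$ are the diameters of $T$, $e$; $h=\max_T h_T$. $\mathcal T_h$ is shape regular: there are fixed positive constants such that (A1) $\rho_v h_T^d\le|T|$ and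 $\rho_e h_e^{d-1}\le|e|$ for all $T$ and all edges/faces $e\subset\partial T$; (A2) $\kappa h_T\le h_e$ for all $e\subset\partial T$; (A3) for every $T$ and $e\subset\partial T$ there is a pyramid contained in $T$ with base $e$, apex $A_e\in T$ and height $\sigma_e h_T$ with $\sigma_e\ge\sigma_*>0$, such that the angle between $x_e-A_e$ and the outward normal of $e$ lies in $[0,\theta_0]$ with $\theta_0<\pi/2$ for all $x_e\in e$; (A4) each $T$ has a shape-regular circumscribed simplex $S(T)$ with diameter at most $\gamma_* h_T$, and each $S(T)$ intersects only a fixed, small number of the other such simplices. **Spaces.** Fix an integer $k\ge1$. $P_r$ denotes polynomials of total degree at most $r$. - $V_h=\prod_T V_k(T)$, where $V_k(T)$ consists of pairs $\mathbf v=\{\mathbf v_0,\mathbf v_b\}$ with $\mathbf v_0\in[P_k(T)]^d$ on $T$ and $\mathbf v_b|_e\in[P_{k-1}(e)]^d$ on each edge/face $e\subset\partial T$ (two values of $\mathbf v_b$ on each interior edge/face). - $[\![\mathbf v]\!]_e=\mathbf v_b|_{\partial T_1}-\mathbf v_b|_{\partial T_2}$ for $e\in\mathcal E_h^0$ shared by $T_1,T_2$; $\mathcal V_h=\{\mathbf v\in V_h:[\![\mathbf v]\!]_e=0\ \forall e\in\mathcal E_h^0\}$, $\mathcal V_h^0=\{\mathbf v\in\mathcal V_h:\mathbf v_b=0\text{ on }\partial\Omega\}$. - $W_h=\{q\in L^2(\Omega):\int_\Omega q=0,\ q|_T\in P_{k-1}(T)\ \forall T\in\mathcal T_h\}$.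 - $\Lambda_k(\partial T)=\{\boldsymbol\lambda:\boldsymbol\lambda|_e\in[P_{k-1}(e)]^d,\ e\subset\partial T\}$, $\Lambda_h=\prod_T\Lambda_k(\partial T)$ (two values on each interior edge/face). The similarity is $\langle\!\langle\boldsymbol\lambda\rangle\!\rangle_e=\boldsymbol\lambda|_{\partial T_1}+\boldsymbol\lambda|_{\partial T_2}$ for $e\in\mathcal E_h^0$ shared by $T_1,T_2$, and $\langle\!\langle\boldsymbol\lambda\rangle\!\rangle_e=0$ for $e\subset\partial\Omega$. - $B_h=\{\boldsymbol\mu:\boldsymbol\mu|_e\in[P_{k-1}(e)]^d,\ e\in\mathcal E_h\}$ (single-valued on each edge/face); $B_h^0$ is the subspace of functions vanishing on $\partial\Omega$. A function of $B_h$ is used as the boundary component $\mathbf v_b$ of a function of $\mathcal V_h$ by restriction to each $\partial T$. **Weak derivatives.** On each $T$, $\nabla_w\mathbf v\in[P_{k-1}(T)]^{d\times d}$ and $\nabla_w\cdot\mathbf v\in P_{k-1}(T)$ are defined by $(\nabla_w\mathbf v,q)_T=-(\mathbf v_0,\nabla\cdot q)_T+\langle\mathbf v_b,q\cdot\mathbf n\rangle_{\partial T}$ for all $q\in[P_{k-1}(T)]^{d\times d}$ (row-wise divergence), and $(\nabla_w\cdot\mathbf v,\varphi)_T=-(\mathbf v_0,\nabla\varphi)_T+\langle\mathbf v_b\cdot\mathbf n,\varphi\rangle_{\partial T}$ for all $\varphi\in P_{k-1}(T)$, with $\mathbf n$ the outward unit normal and $L^2$ inner products. **Forms.** $Q_b$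 is the $L^2$ projection from $[L^2(e)]^d$ onto $[P_{k-1}(e)]^d$ on each $e$. $a_T(\mathbf v,\mathbf w)=(\nabla_w\mathbf v,\nabla_w\mathbf w)_T+h_T^{-1}\langle Q_b\mathbf v_0-\mathbf v_b,Q_b\mathbf w_0-\mathbf w_b\rangle_{\partial T}$, $b_T(\mathbf v,q)=(\nabla_w\cdot\mathbf v,q)_T$, $c_T(\mathbf v,\boldsymbol\lambda)=\langle\mathbf v_b,\boldsymbol\lambda\rangle_{\partial T}$; $a,b$ are the sums of $a_T,b_T$ over $T\in\mathcal T_h$. **Scheme (WG).** Find $\bar{\mathbf u}_h=\{\bar{\mathbf u}_0,\bar{\mathbf u}_b\}\in\mathcal V_h$, $\bar p_h\in W_h$ with $\bar{\mathbf u}_b=Q_b\mathbf g$ on $\partial\Omega$ and $a(\bar{\mathbf u}_h,\mathbf v)-b(\mathbf v,\bar p_h)=(\mathbf f,\mathbf v_0)$, $b(\bar{\mathbf u}_h,q)=0$ for all $\mathbf v=\{\mathbf v_0,\mathbf v_b\}\in\mathcal V_h^0$, $q\in W_h$. (It is known to have a unique solution.) **Operator $S_{\mathbf f}$.** For a fixed $p_h\in W_h$ and any given $\mathbf w_b\in B_h$: Step 1: on each $T$ let $\mathbf w_0=D_{\mathbf f}(\mathbf w_b;p_h)\in[P_k(T)]^d$ be the solution of $a_T(\mathbf w_h,\mathbf v)-b_T(\mathbf v,p_h)=(\mathbf f,\mathbf v_0)_T$ for all $\mathbf v=\{\mathbf v_0,\mathbf 0\}\in V_k(T)$, where $\mathbf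 w_h=\{\mathbf w_0,\mathbf w_b\}$. Step 2: on each $T$ let $\boldsymbol\zeta_{h,T}\in\Lambda_k(\partial T)$ be the solution of $c_T(\mathbf v,\boldsymbol\zeta_{h,T})=a_T(\mathbf w_h,\mathbf v)-b_T(\mathbf v,p_h)$ for all $\mathbf v=\{\mathbf 0,\mathbf v_b\}\in V_k(T)$; this defines $\boldsymbol\zeta_h\in\Lambda_h$. Step 3: $S_{\mathbf f}(\mathbf w_b;p_h)=\langle\!\langle\boldsymbol\zeta_h\rangle\!\rangle\in B_h^0$ (zero on boundary edges/faces).
   Formalization: The operator equation alone does not imply the discrete divergence equation, so the printed "if" direction is false; the formal right-hand side is S_f(u_b;p_h)=0 together with b(u_h,q)=0 for all q in W_h. *)

theory Defs
  imports "HOL-Analysis.Analysis"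
begin

section \<open>Surface measure on flat sets\<close>

text \<open>The library has no \<open>(d-1)\<close>-dimensional Lebesgue measure on hyperplanes. For a set \<open>e\<close>
  spanning a hyperplane \<open>{x. n \<bullet> x = c}\<close> it is obtained here by projecting \<open>d\<close>-dimensional
  Lebesgue measure on the slab of thickness one over this hyperplane orthogonally onto it.
  The two admissible choices \<open>(n, c)\<close> and \<open>(-n, -c)\<close> give the same measure.\<close>

definition surf :: "(real^'d) set \<Rightarrow> (real^'d) measure" where
  "surf e = (let (n, c) = (SOME (n, c). norm n = 1 \<and> e \<subseteq> {x. n \<bullet> x = c}) in
     completion (distr (restrict_space lborel {x. c \<le> n \<bullet> x \<and> n \<bullet> x \<le> c + 1}) borel
       (\<lambda>x. x - (n \<bullet> x - c) *\<^sub>R n)))"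


section \<open>Inner products and square integrability\<close>

text \<open>On \<open>real^'d^'d\<close> the inner product is the Frobenius product, on \<open>real\<close> it is multiplication.\<close>

definition ip :: "'a measure \<Rightarrow> 'a set \<Rightarrow> ('a \<Rightarrow> 'b) \<Rightarrow> ('a \<Rightarrow> 'b::real_inner) \<Rightarrow> real" where
  "ip M S f g = (LINT x:S|M. f x \<bullet> g x)"

definition square_integrable :: "'a measure \<Rightarrow> 'a set \<Rightarrow> ('a \<Rightarrow> 'b::euclidean_space) \<Rightarrow> bool" where
  "square_integrable M S f \<longleftrightarrow>
     set_borel_measurable M S f \<and> set_integrable M S (\<lambda>x. (norm (f x))\<^sup>2)"


section \<open>Polygonal and polyhedral domains and meshes\<close>

text \<open>Bounded open polygons and polyhedra, not necessarily convex.\<close>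

definition polyhedral_domain :: "(real^'d) set \<Rightarrow> bool" where
  "polyhedral_domain D \<longleftrightarrow> open D \<and> connected D \<and> D \<noteq> {} \<and> interior (closure D) = D \<and>
     (\<exists>\<P>. finite \<P> \<and> (\<forall>P\<in>\<P>. polytope P) \<and> closure D = \<Union>\<P>)"

text \<open>Closed edges (\<open>d = 2\<close>) or closed flat polygonal faces (\<open>d = 3\<close>), not necessarily convex.\<close>

definition flat_face :: "(real^'d) set \<Rightarrow> bool" where
  "flat_face e \<longleftrightarrow> aff_dim e = int CARD('d) - 1 \<and> connected (rel_interior e) \<and>
     (\<exists>\<P>. finite \<P> \<and> (\<forall>P\<in>\<P>. polytope P \<and> aff_dim P = int CARD('d) - 1) \<and> e = \<Union>\<P>)"

definition outward_normal :: "(real^'d) set \<Rightarrow> (real^'d) set \<Rightarrow> real^'d \<Rightarrow> bool" where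
  "outward_normal T e n \<longleftrightarrow> norm n = 1 \<and> (\<forall>x\<in>e. \<forall>y\<in>e. n \<bullet> (x - y) = 0) \<and>
     (AE x in surf e. x \<in> e \<longrightarrow>
        (\<forall>\<^sub>F t in at_right 0. x - t *\<^sub>R n \<in> T \<and> x + t *\<^sub>R n \<notin> T))"

definition normal :: "(real^'d) set \<Rightarrow> (real^'d) set \<Rightarrow> real^'d" where
  "normal T e = (SOME n. outward_normal T e n)"

text \<open>The edges/faces \<open>e \<subset> \<partial>T\<close> of the mesh; a geometric side of \<open>T\<close> may consist of
  several of them (hanging nodes).\<close>

definition faces :: "(real^'d) set set \<Rightarrow> (real^'d) set \<Rightarrow> (real^'d) set set" where
  "faces \<E> T = {e \<in> \<E>. e \<subseteq> frontier T}"

definition boundary_faces :: "(real^'d) set \<Rightarrow> (real^'d) set set \<Rightarrow> (real^'d) set set" where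
  "boundary_faces \<Omega> \<E> = {e \<in> \<E>. e \<subseteq> frontier \<Omega>}"

definition interior_faces :: "(real^'d) set \<Rightarrow> (real^'d) set set \<Rightarrow> (real^'d) set set" where
  "interior_faces \<Omega> \<E> = \<E> - boundary_faces \<Omega> \<E>"

definition cells_at :: "(real^'d) set set \<Rightarrow> (real^'d) set \<Rightarrow> (real^'d) set set" where
  "cells_at \<T> e = {T \<in> \<T>. e \<subseteq> frontier T}"

definition mesh :: "(real^'d) set \<Rightarrow> (real^'d) set set \<Rightarrow> (real^'d) set set \<Rightarrow> bool" where
  "mesh \<Omega> \<T> \<E> \<longleftrightarrow>
     finite \<T> \<and> (\<forall>T\<in>\<T>. polyhedral_domain T) \<and> disjoint \<T> \<and>
     closure \<Omega> = (\<Union>T\<in>\<T>. closure T) \<and>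
     finite \<E> \<and> (\<forall>e\<in>\<E>. flat_face e) \<and>
     (\<forall>e\<in>\<E>. \<forall>e'\<in>\<E>. e \<noteq> e' \<longrightarrow> rel_interior e \<inter> rel_interior e' = {}) \<and>
     (\<forall>T\<in>\<T>. frontier T = \<Union>(faces \<E> T)) \<and>
     (\<forall>T\<in>\<T>. \<forall>e\<in>faces \<E> T. \<exists>n. outward_normal T e n) \<and>
     (\<forall>e\<in>boundary_faces \<Omega> \<E>. card (cells_at \<T> e) = 1) \<and>
     (\<forall>e\<in>interior_faces \<Omega> \<E>. card (cells_at \<T> e) = 2)"

definition pyramid :: "real^'d \<Rightarrow> (real^'d) set \<Rightarrow> (real^'d) set" where
  "pyramid A e = {(1 - s) *\<^sub>R A + s *\<^sub>R x | s x. 0 \<le> s \<and> s \<le> 1 \<and> x \<in> e}"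

definition angle :: "real^'d \<Rightarrow> real^'d \<Rightarrow> real" where
  "angle u v = arccos ((u \<bullet> v) / (norm u * norm v))"

text \<open>Since cells are open, inclusion of a pyramid with base on \<open>\<partial>T\<close> refers to the closure of \<open>T\<close>. Shape
  regularity of the circumscribed simplices \<open>S(T)\<close> is expressed by an inscribed ball whose radius
  is at least \<open>\<rho>s\<close> times the diameter.\<close>

definition shape_regular ::
  "(real^'d) set set \<Rightarrow> (real^'d) set set \<Rightarrow> real \<Rightarrow> real \<Rightarrow> real \<Rightarrow> real \<Rightarrow> real \<Rightarrow> real \<Rightarrow> real \<Rightarrow> nat
     \<Rightarrow> bool" where
  "shape_regular \<T> \<E> \<rho>v \<rho>e \<kappa> \<sigma>s \<theta>0 \<gamma>s \<rho>s N \<longleftrightarrow>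
     0 < \<rho>v \<and> 0 < \<rho>e \<and> 0 < \<kappa> \<and> 0 < \<sigma>s \<and> 0 \<le> \<theta>0 \<and> \<theta>0 < pi / 2 \<and> 0 < \<gamma>s \<and> 0 < \<rho>s \<and>
     (\<forall>T\<in>\<T>. \<rho>v * diameter T ^ CARD('d) \<le> measure lebesgue T \<and>
        (\<forall>e\<in>faces \<E> T. \<rho>e * diameter e ^ (CARD('d) - 1) \<le> measure (surf e) e)) \<and>
     (\<forall>T\<in>\<T>. \<forall>e\<in>faces \<E> T. \<kappa> * diameter T \<le> diameter e) \<and>
     (\<forall>T\<in>\<T>. \<forall>e\<in>faces \<E> T. \<exists>A\<in>T. \<exists>\<sigma>\<ge>\<sigma>s.
        pyramid A e \<subseteq> closure T \<and> infdist A (affine hull e) = \<sigma> * diameter T \<and>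
        (\<forall>x\<in>e. angle (x - A) (normal T e) \<le> \<theta>0)) \<and>
     (\<exists>S. \<forall>T\<in>\<T>.
        int CARD('d) simplex S T \<and> T \<subseteq> S T \<and> diameter (S T) \<le> \<gamma>s * diameter T \<and>
        (\<exists>z. cball z (\<rho>s * diameter (S T)) \<subseteq> S T) \<and>
        card {T'\<in>\<T>. T' \<noteq> T \<and> S T \<inter> S T' \<noteq> {}} \<le> N)"


section \<open>Polynomial spaces\<close>

definition Pol :: "nat \<Rightarrow> (real^'d \<Rightarrow> real) set" where
  "Pol r = {p. \<exists>c. p = (\<lambda>x. \<Sum>\<alpha> | (\<Sum>i\<in>UNIV. \<alpha> i) \<le> r. c \<alpha> * (\<Prod>i\<in>UNIV. (x $ i) ^ \<alpha> i))}"

text \<open>Cells have nonempty interior, so a polynomial on a cell \<open>T\<close> is identified with the polynomial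
  function on the whole space; this also provides its trace on \<open>\<partial>T\<close>.\<close>

definition PolV :: "nat \<Rightarrow> (real^'d \<Rightarrow> real^'d) set" where
  "PolV r = {v. \<forall>i. (\<lambda>x. v x $ i) \<in> Pol r}"

definition PolM :: "nat \<Rightarrow> (real^'d \<Rightarrow> real^'d^'d) set" where
  "PolM r = {q. \<forall>i j. (\<lambda>x. q x $ i $ j) \<in> Pol r}"

text \<open>A polynomial on an edge/face \<open>e\<close> is determined only by its values on \<open>e\<close>; it is represented
  by its extension by zero.\<close>

definition PolF :: "nat \<Rightarrow> (real^'d) set \<Rightarrow> (real^'d \<Rightarrow> real^'d) set" where
  "PolF r e = {\<lambda>x. if x \<in> e then p x else 0 | p. p \<in> PolV r}"


section \<open>Discrete spaces\<close>

text \<open>A function on edges/faces maps an edge/face to a vector field on it. Elements of products over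
  cells are functions of the cell. In all these product spaces the values at sets outside the
  index set of the product are irrelevant, so that restricting an element of \<open>B\<^sub>h\<close> to \<open>\<partial>T\<close> does
  not change its representation.\<close>

type_synonym 'd vfield = "real^'d \<Rightarrow> real^'d"
type_synonym 'd ffield = "(real^'d) set \<Rightarrow> 'd vfield"
type_synonym 'd weakfun = "'d vfield \<times> 'd ffield"

definition Lambda_loc :: "nat \<Rightarrow> (real^'d) set set \<Rightarrow> (real^'d) set \<Rightarrow> ('d ffield) set" where
  "Lambda_loc k \<E> T = (\<Pi> e\<in>faces \<E> T. PolF (k - 1) e)"

definition V_loc :: "nat \<Rightarrow> (real^'d) set set \<Rightarrow> (real^'d) set \<Rightarrow> ('d weakfun) set" where
  "V_loc k \<E> T = PolV k \<times> Lambda_loc k \<E> T"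

definition Vh ::
  "nat \<Rightarrow> (real^'d) set set \<Rightarrow> (real^'d) set set \<Rightarrow> ((real^'d) set \<Rightarrow> 'd weakfun) set" where
  "Vh k \<T> \<E> = (\<Pi> T\<in>\<T>. V_loc k \<E> T)"

definition jump :: "((real^'d) set \<Rightarrow> 'd weakfun) \<Rightarrow> (real^'d) set \<Rightarrow> (real^'d) set \<Rightarrow> 'd ffield" where
  "jump v T1 T2 = (\<lambda>e x. snd (v T1) e x - snd (v T2) e x)"

definition Vh_cont :: "nat \<Rightarrow> (real^'d) set \<Rightarrow> (real^'d) set set \<Rightarrow> (real^'d) set set
    \<Rightarrow> ((real^'d) set \<Rightarrow> 'd weakfun) set" where
  "Vh_cont k \<Omega> \<T> \<E> = {v \<in> Vh k \<T> \<E>. \<forall>e\<in>interior_faces \<Omega> \<E>.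
     \<forall>T1\<in>cells_at \<T> e. \<forall>T2\<in>cells_at \<T> e. T1 \<noteq> T2 \<longrightarrow> jump v T1 T2 e = (\<lambda>x. 0)}"

definition Vh_cont0 :: "nat \<Rightarrow> (real^'d) set \<Rightarrow> (real^'d) set set \<Rightarrow> (real^'d) set set
    \<Rightarrow> ((real^'d) set \<Rightarrow> 'd weakfun) set" where
  "Vh_cont0 k \<Omega> \<T> \<E> = {v \<in> Vh_cont k \<Omega> \<T> \<E>. \<forall>e\<in>boundary_faces \<Omega> \<E>.
     \<forall>T\<in>cells_at \<T> e. snd (v T) e = (\<lambda>x. 0)}"

definition Wh :: "nat \<Rightarrow> (real^'d) set \<Rightarrow> (real^'d) set set \<Rightarrow> (real^'d \<Rightarrow> real) set" where
  "Wh k \<Omega> \<T> = {q. square_integrable lebesgue \<Omega> q \<and> (LINT x:\<Omega>|lebesgue. q x) = 0 \<and>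
     (\<forall>T\<in>\<T>. \<exists>p\<in>Pol (k - 1). \<forall>x\<in>T. q x = p x)}"

definition Bh :: "nat \<Rightarrow> (real^'d) set set \<Rightarrow> ('d ffield) set" where
  "Bh k \<E> = (\<Pi> e\<in>\<E>. PolF (k - 1) e)"

definition similarity :: "(real^'d) set \<Rightarrow> (real^'d) set set \<Rightarrow> (real^'d) set set
    \<Rightarrow> ((real^'d) set \<Rightarrow> 'd ffield) \<Rightarrow> 'd ffield" where
  "similarity \<Omega> \<T> \<E> \<mu> = (\<lambda>e x.
     if e \<in> interior_faces \<Omega> \<E> then \<Sum>T\<in>cells_at \<T> e. \<mu> T e x else 0)"


section \<open>Weak derivatives and forms\<close>

text \<open>The projection, the weak derivatives and the solutions of the local problems are each determined
  by a uniquely solvable finite-dimensional linear system; the solution is selected by Hilbert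
  choice.\<close>

definition grad :: "(real^'d \<Rightarrow> real) \<Rightarrow> real^'d \<Rightarrow> real^'d" where
  "grad \<phi> x = (\<chi> j. frechet_derivative \<phi> (at x) (axis j 1))"

definition row_div :: "(real^'d \<Rightarrow> real^'d^'d) \<Rightarrow> real^'d \<Rightarrow> real^'d" where
  "row_div q x = (\<chi> i. \<Sum>j\<in>UNIV. frechet_derivative (\<lambda>y. q y $ i $ j) (at x) (axis j 1))"

definition weak_grad ::
  "nat \<Rightarrow> (real^'d) set set \<Rightarrow> (real^'d) set \<Rightarrow> 'd weakfun \<Rightarrow> real^'d \<Rightarrow> real^'d^'d" where
  "weak_grad k \<E> T v = (SOME G. G \<in> PolM (k - 1) \<and> (\<forall>q\<in>PolM (k - 1).
     ip lebesgue T G q = - ip lebesgue T (fst v) (row_div q)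
       + (\<Sum>e\<in>faces \<E> T. ip (surf e) e (snd v e) (\<lambda>x. q x *v normal T e))))"

definition weak_div ::
  "nat \<Rightarrow> (real^'d) set set \<Rightarrow> (real^'d) set \<Rightarrow> 'd weakfun \<Rightarrow> real^'d \<Rightarrow> real" where
  "weak_div k \<E> T v = (SOME D. D \<in> Pol (k - 1) \<and> (\<forall>\<phi>\<in>Pol (k - 1).
     ip lebesgue T D \<phi> = - ip lebesgue T (fst v) (grad \<phi>)
       + (\<Sum>e\<in>faces \<E> T. ip (surf e) e (\<lambda>x. snd v e x \<bullet> normal T e) \<phi>)))"

definition Qb :: "nat \<Rightarrow> (real^'d) set \<Rightarrow> 'd vfield \<Rightarrow> 'd vfield" where
  "Qb k e v = (SOME p. p \<in> PolF (k - 1) e \<and> (\<forall>w\<in>PolF (k - 1) e.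
     ip (surf e) e p w = ip (surf e) e v w))"

definition a_loc ::
  "nat \<Rightarrow> (real^'d) set set \<Rightarrow> (real^'d) set \<Rightarrow> 'd weakfun \<Rightarrow> 'd weakfun \<Rightarrow> real" where
  "a_loc k \<E> T v w = ip lebesgue T (weak_grad k \<E> T v) (weak_grad k \<E> T w)
     + inverse (diameter T) * (\<Sum>e\<in>faces \<E> T. ip (surf e) e
         (\<lambda>x. Qb k e (fst v) x - snd v e x) (\<lambda>x. Qb k e (fst w) x - snd w e x))"

definition b_loc ::
  "nat \<Rightarrow> (real^'d) set set \<Rightarrow> (real^'d) set \<Rightarrow> 'd weakfun \<Rightarrow> (real^'d \<Rightarrow> real) \<Rightarrow> real" where
  "b_loc k \<E> T v q = ip lebesgue T (weak_div k \<E> T v) q"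

definition c_loc :: "(real^'d) set set \<Rightarrow> (real^'d) set \<Rightarrow> 'd weakfun \<Rightarrow> 'd ffield \<Rightarrow> real" where
  "c_loc \<E> T v \<mu> = (\<Sum>e\<in>faces \<E> T. ip (surf e) e (snd v e) (\<mu> e))"

definition a_form :: "nat \<Rightarrow> (real^'d) set set \<Rightarrow> (real^'d) set set
    \<Rightarrow> ((real^'d) set \<Rightarrow> 'd weakfun) \<Rightarrow> ((real^'d) set \<Rightarrow> 'd weakfun) \<Rightarrow> real" where
  "a_form k \<T> \<E> v w = (\<Sum>T\<in>\<T>. a_loc k \<E> T (v T) (w T))"

definition b_form :: "nat \<Rightarrow> (real^'d) set set \<Rightarrow> (real^'d) set set
    \<Rightarrow> ((real^'d) set \<Rightarrow> 'd weakfun) \<Rightarrow> (real^'d \<Rightarrow> real) \<Rightarrow> real" where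
  "b_form k \<T> \<E> v q = (\<Sum>T\<in>\<T>. b_loc k \<E> T (v T) q)"


section \<open>The weak Galerkin scheme and the operator \<open>S\<^sub>f\<close>\<close>

definition wg_solution :: "nat \<Rightarrow> (real^'d) set \<Rightarrow> (real^'d) set set \<Rightarrow> (real^'d) set set
    \<Rightarrow> 'd vfield \<Rightarrow> 'd vfield \<Rightarrow> ((real^'d) set \<Rightarrow> 'd weakfun) \<Rightarrow> (real^'d \<Rightarrow> real) \<Rightarrow> bool" where
  "wg_solution k \<Omega> \<T> \<E> f g u p \<longleftrightarrow>
     u \<in> Vh_cont k \<Omega> \<T> \<E> \<and> p \<in> Wh k \<Omega> \<T> \<and>
     (\<forall>e\<in>boundary_faces \<Omega> \<E>. \<forall>T\<in>cells_at \<T> e. snd (u T) e = Qb k e g) \<and>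
     (\<forall>v\<in>Vh_cont0 k \<Omega> \<T> \<E>.
        a_form k \<T> \<E> u v - b_form k \<T> \<E> v p = (\<Sum>T\<in>\<T>. ip lebesgue T f (fst (v T)))) \<and>
     (\<forall>q\<in>Wh k \<Omega> \<T>. b_form k \<T> \<E> u q = 0)"

definition local_solution :: "nat \<Rightarrow> (real^'d) set set \<Rightarrow> (real^'d) set \<Rightarrow> 'd vfield \<Rightarrow> 'd ffield
    \<Rightarrow> (real^'d \<Rightarrow> real) \<Rightarrow> 'd vfield \<Rightarrow> bool" where
  "local_solution k \<E> T f wb p w0 \<longleftrightarrow> w0 \<in> PolV k \<and>
     (\<forall>v0\<in>PolV k. a_loc k \<E> T (w0, wb) (v0, \<lambda>e x. 0) - b_loc k \<E> T (v0, \<lambda>e x. 0) p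
        = ip lebesgue T f v0)"

definition D_op :: "nat \<Rightarrow> (real^'d) set set \<Rightarrow> (real^'d) set \<Rightarrow> 'd vfield \<Rightarrow> 'd ffield
    \<Rightarrow> (real^'d \<Rightarrow> real) \<Rightarrow> 'd vfield" where
  "D_op k \<E> T f wb p = (SOME w0. local_solution k \<E> T f wb p w0)"

definition zeta :: "nat \<Rightarrow> (real^'d) set set \<Rightarrow> 'd vfield \<Rightarrow> 'd ffield \<Rightarrow> (real^'d \<Rightarrow> real)
    \<Rightarrow> (real^'d) set \<Rightarrow> 'd ffield" where
  "zeta k \<E> f wb p T = (SOME \<zeta>. \<zeta> \<in> Lambda_loc k \<E> T \<and> (\<forall>vb\<in>Lambda_loc k \<E> T.
     c_loc \<E> T (\<lambda>x. 0, vb) \<zeta>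
       = a_loc k \<E> T (D_op k \<E> T f wb p, wb) (\<lambda>x. 0, vb) - b_loc k \<E> T (\<lambda>x. 0, vb) p))"

definition S_op :: "nat \<Rightarrow> (real^'d) set \<Rightarrow> (real^'d) set set \<Rightarrow> (real^'d) set set \<Rightarrow> 'd vfield
    \<Rightarrow> 'd ffield \<Rightarrow> (real^'d \<Rightarrow> real) \<Rightarrow> 'd ffield" where
  "S_op k \<Omega> \<T> \<E> f wb p = similarity \<Omega> \<T> \<E> (zeta k \<E> f wb p)"

end

theory Submission
  imports Defs "HOL-Library.Function_Algebras"
begin

text \<open>Let \<open>u\<close> consist of a boundary function \<open>u\<^sub>b\<close> and the solutions \<open>u\<^sub>0\<close> of the local problems. For a
  weak function \<open>v = {v\<^sub>0, v\<^sub>b}\<close> on a cell \<open>T\<close> the residual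
  \<open>a\<^sub>T(u, v) - b\<^sub>T(v, p) - (f, v\<^sub>0)\<^sub>T\<close> does not change if \<open>v\<^sub>0\<close> is replaced by zero, because
  \<open>u\<^sub>0\<close> solves the local problem; and for \<open>v\<^sub>0 = 0\<close> the residual is \<open>\<langle>v\<^sub>b, \<zeta>\<rangle>\<close> over the boundary
  of \<open>T\<close>, by the definition of the flux \<open>\<zeta>\<close> (\<open>residual_eq_c_loc\<close>). Summed over the
  cells, the momentum equation of the scheme says that the total of the \<open>\<langle>v\<^sub>b, \<zeta>\<rangle>\<close> vanishes for all
  single-valued \<open>v\<^sub>b\<close> that are zero on the boundary. Each interior face receives the flux from both
  adjacent cells, so this total is the sum over the interior faces of the products of
  \<open>v\<^sub>b\<close> with the similarity of \<open>\<zeta>\<close>, which is \<open>S\<^sub>f(u\<^sub>b; p)\<close> (\<open>sum_c_loc_eq_similarity\<close>). The choice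
  \<open>v\<^sub>b = S\<^sub>f(u\<^sub>b; p)\<close> shows that it vanishes for all \<open>v\<^sub>b\<close> only if \<open>S\<^sub>f(u\<^sub>b; p) = 0\<close>
  (\<open>similarity_zero_iff\<close>). The discrete incompressibility condition is common to both sides, and
  the boundary condition holds by assumption.

  This computation needs the forms to be bilinear and the selected solutions
  (weak derivatives, projections, local solutions, fluxes) to solve their systems. All these
  systems are Riesz representation problems on finite-dimensional polynomial spaces. They are
  solved for semi-inner products (\<open>riesz\<close>): a functional is representable as soon as it
  vanishes on null vectors. Functions vanishing on the closure of the cell or on the face are the
  only null vectors (\<open>ip_self_eq_0\<close>), which holds on a face because every relatively open
  part of it has positive surface measure (\<open>L2_domain_face\<close>). The local form \<open>a\<^sub>T\<close> is
  itself a semi-inner product, and null vectors of a semi-inner product are orthogonal to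
  everything. Hence the difference of two local solutions, being null, is invisible to \<open>a\<^sub>T\<close>, and the
  solution selected in the definition of \<open>S\<^sub>f\<close> may be exchanged for \<open>u\<^sub>0\<close>
  (\<open>a_loc_local_solution_unique\<close>).\<close>

section \<open>Functions as vectors\<close>

text \<open>Scalar fields, vector fields, face fields and pairs of them become real vectors with pointwise
  operations. This makes spans, subspaces and linear maps available for the polynomial
  spaces and for the product spaces of weak functions alike.\<close>

instantiation "fun" :: (type, real_vector) real_vector
begin

definition "c *\<^sub>R f = (\<lambda>x. c *\<^sub>R f x)"

instance
  by standard (simp_all add: scaleR_fun_def fun_eq_iff scaleR_add_right scaleR_add_left)

end

lemma scaleR_fun_apply [simp]: "(c *\<^sub>R f) x = c *\<^sub>R f x"
  by (simp add: scaleR_fun_def)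

section \<open>Semi-inner products on subspaces\<close>

text \<open>Linearity is required only on a subspace, because the forms of the scheme are built
  from integrals and from choices of solutions, which are additive only for admissible functions.\<close>

definition linear_functional_on :: "'v::real_vector set \<Rightarrow> ('v \<Rightarrow> real) \<Rightarrow> bool" where
  "linear_functional_on V l \<longleftrightarrow>
     (\<forall>x\<in>V. \<forall>y\<in>V. l (x + y) = l x + l y) \<and> (\<forall>c. \<forall>x\<in>V. l (c *\<^sub>R x) = c * l x)"

lemma linear_functional_on_add:
  "linear_functional_on V l \<Longrightarrow> linear_functional_on V m \<Longrightarrow> linear_functional_on V (\<lambda>x. l x + m x)"
  by (simp add: linear_functional_on_def algebra_simps)

lemma linear_functional_on_minus:
  "linear_functional_on V l \<Longrightarrow> linear_functional_on V (\<lambda>x. - l x)"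
  by (simp add: linear_functional_on_def algebra_simps)

lemma linear_functional_on_cmult:
  "linear_functional_on V l \<Longrightarrow> linear_functional_on V (\<lambda>x. c * l x)"
  by (simp add: linear_functional_on_def algebra_simps)

lemma linear_functional_on_sum:
  "(\<And>i. i \<in> I \<Longrightarrow> linear_functional_on V (l i)) \<Longrightarrow> linear_functional_on V (\<lambda>x. \<Sum>i\<in>I. l i x)"
  by (simp add: linear_functional_on_def sum.distrib sum_distrib_left)

lemma linear_functional_on_subset:
  "linear_functional_on V l \<Longrightarrow> W \<subseteq> V \<Longrightarrow> linear_functional_on W l"
  by (simp add: linear_functional_on_def subset_iff)

lemma linear_functional_on_zero:
  assumes "linear_functional_on V l" "0 \<in> V" shows "l 0 = 0"
  using assms by (metis linear_functional_on_def mult_zero_left scaleR_zero_left)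

lemma linear_functional_on_diff:
  assumes "linear_functional_on V l" "subspace V" "x \<in> V" "y \<in> V" shows "l (x - y) = l x - l y"
proof -
  have "l (x + (-1) *\<^sub>R y) = l x + (-1) * l y"
    using assms subspace_scale[OF assms(2,4), of "-1"] unfolding linear_functional_on_def by metis
  then show ?thesis by simp
qed

lemma linear_functional_on_image_sum:
  assumes l: "linear_functional_on V l" and V: "subspace V" and "finite I" "\<And>i. i \<in> I \<Longrightarrow> f i \<in> V"
  shows "l (\<Sum>i\<in>I. f i) = (\<Sum>i\<in>I. l (f i))"
  using assms(3,4)
proof (induction I)
  case empty
  then show ?case by (simp add: linear_functional_on_zero[OF l subspace_0[OF V]])
next
  case (insert i I)
  then have "(\<Sum>i\<in>I. f i) \<in> V" by (simp add: V subspace_sum)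
  with insert l show ?case by (simp add: linear_functional_on_def)
qed

locale semi_inner_product =
  fixes V :: "'v::real_vector set" and B :: "'v \<Rightarrow> 'v \<Rightarrow> real"
  assumes subspace: "subspace V"
    and linear: "y \<in> V \<Longrightarrow> linear_functional_on V (\<lambda>x. B x y)"
    and commute: "x \<in> V \<Longrightarrow> y \<in> V \<Longrightarrow> B x y = B y x"
    and nonneg: "x \<in> V \<Longrightarrow> 0 \<le> B x x"
begin

lemma add_left: "x \<in> V \<Longrightarrow> y \<in> V \<Longrightarrow> z \<in> V \<Longrightarrow> B (x + y) z = B x z + B y z"
  using linear by (simp add: linear_functional_on_def)

lemma scale_left: "x \<in> V \<Longrightarrow> z \<in> V \<Longrightarrow> B (c *\<^sub>R x) z = c * B x z"
  using linear by (simp add: linear_functional_on_def)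

lemma diff_left: "x \<in> V \<Longrightarrow> y \<in> V \<Longrightarrow> z \<in> V \<Longrightarrow> B (x - y) z = B x z - B y z"
  by (rule linear_functional_on_diff[OF linear subspace])

lemma add_right: "x \<in> V \<Longrightarrow> y \<in> V \<Longrightarrow> z \<in> V \<Longrightarrow> B z (x + y) = B z x + B z y"
  by (metis add_left commute subspace subspace_add)

lemma scale_right: "x \<in> V \<Longrightarrow> z \<in> V \<Longrightarrow> B z (c *\<^sub>R x) = c * B z x"
  by (metis scale_left commute subspace subspace_scale)

lemma zero_left: "y \<in> V \<Longrightarrow> B 0 y = 0"
  by (rule linear_functional_on_zero[OF linear subspace_0[OF subspace]])

text \<open>The polynomial \<open>t \<mapsto> B (y + t x) (y + t x)\<close> is nonnegative, and for a null vector
  \<open>x\<close> it is affine with slope \<open>2 B x y\<close>.\<close>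

lemma null_left:
  assumes x: "x \<in> V" and y: "y \<in> V" and null: "B x x = 0"
  shows "B x y = 0"
proof (rule ccontr)
  assume ne: "B x y \<noteq> 0"
  have expand: "0 \<le> B y y + 2 * t * B x y" for t
  proof -
    have tx: "t *\<^sub>R x \<in> V" by (simp add: subspace subspace_scale x)
    have "0 \<le> B (y + t *\<^sub>R x) (y + t *\<^sub>R x)"
      by (simp add: nonneg subspace subspace_add tx y)
    also have "\<dots> = B y y + 2 * t * B x y"
      using x y tx null commute[OF x y]
      by (simp add: add_left add_right scale_left scale_right subspace subspace_add)
    finally show ?thesis .
  qed
  \<comment> \<open>At this \<open>t\<close> the affine function has the value \<open>-1\<close>.\<close>
  from expand[of "- (B y y + 1) / (2 * B x y)"] ne show False
    by (simp add: field_simps)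
qed

text \<open>Without definiteness a functional is still represented, provided that it vanishes on
  null vectors. The induction on the spanning set is a Gram--Schmidt step: the representative
  \<open>p\<close> of \<open>v \<mapsto> B v a\<close> on the old span is the projection of the new vector \<open>a\<close>, and the old
  representative \<open>q\<close> of \<open>l\<close> is corrected along \<open>r = a - p\<close>, or not at all if \<open>r\<close> is null.\<close>

lemma riesz:
  assumes "finite S" "S \<subseteq> V" "linear_functional_on V l"
    and "\<And>x. x \<in> V \<Longrightarrow> B x x = 0 \<Longrightarrow> l x = 0"
  shows "\<exists>p\<in>span S. \<forall>v\<in>span S. B p v = l v"
  using assms
proof (induction S arbitrary: l rule: finite_induct)
  case empty
  then show ?case
    by (auto simp: linear_functional_on_zero[OF empty.prems(2) subspace_0[OF subspace]]
        intro: zero_left subspace_0[OF subspace])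
next
  case (insert a S)
  have sub: "span S \<subseteq> V" and S: "S \<subseteq> V" and a: "a \<in> V"
    using insert.prems(1) span_minimal[OF _ subspace] by auto
  obtain p where p: "p \<in> span S" "\<And>v. v \<in> span S \<Longrightarrow> B p v = B v a"
    using insert.IH[OF S linear[OF a]] null_left a by blast
  obtain q where q: "q \<in> span S" "\<And>v. v \<in> span S \<Longrightarrow> B q v = l v"
    using insert.IH[OF S insert.prems(2,3)] by blast
  define r where "r = a - p"
  have pV: "p \<in> V" and qV: "q \<in> V" using p q sub by auto
  have r: "r \<in> V" unfolding r_def by (simp add: a pV subspace subspace_diff)
  have orth: "B r v = 0" "B v r = 0" if "v \<in> span S" for v
    using that p(2)[OF that] a pV commute[of v a] commute[of v r] r subspace sub
    by (auto simp: r_def diff_left)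
  define c where "c = (if B r r = 0 then 0 else l r / B r r)"
  have cr: "c * B r r = l r"
    using insert.prems(3)[OF r] by (simp add: c_def)
  have r_span: "r \<in> span (insert a S)"
    unfolding r_def using p(1) by (meson insertI1 span_base span_diff span_mono subsetD subset_insertI)
  show ?case
  proof (intro bexI ballI)
    show "q + c *\<^sub>R r \<in> span (insert a S)"
      using q(1) r_span by (meson span_add span_scale span_mono subsetD subset_insertI)
    fix v assume "v \<in> span (insert a S)"
    then obtain t where "v - t *\<^sub>R a \<in> span S" by (auto simp: span_breakdown_eq)
    then have w: "v - t *\<^sub>R r \<in> span S"
      using span_add[OF _ span_scale[OF p(1), of t]] by (fastforce simp: r_def algebra_simps)
    define w where "w = v - t *\<^sub>R r"
    have w: "w \<in> span S" "w \<in> V" "v = w + t *\<^sub>R r" using w sub by (auto simp: w_def)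
    have trV: "t *\<^sub>R r \<in> V" "c *\<^sub>R r \<in> V" by (simp_all add: r subspace subspace_scale)
    have "B (q + c *\<^sub>R r) v = B q w + c * B r w + t * B q r + t * (c * B r r)"
      using w trV qV r by (simp add: add_left add_right scale_left scale_right subspace subspace_add algebra_simps)
    also have "\<dots> = l w + t * l r" by (simp add: q w orth cr)
    also have "\<dots> = l v"
      using insert.prems(2) w(2) r trV by (simp add: w(3) linear_functional_on_def)
    finally show "B (q + c *\<^sub>R r) v = l v" .
  qed
qed

end

section \<open>The polynomial spaces are finitely spanned\<close>

definition finitely_spanned :: "'v::real_vector set \<Rightarrow> bool" where
  "finitely_spanned V \<longleftrightarrow> (\<exists>S. finite S \<and> V = span S)"

lemma finitely_spanned_subspace: "finitely_spanned V \<Longrightarrow> subspace V"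
  by (auto simp: finitely_spanned_def)

lemma finitely_spanned_linear_image:
  "Real_Vector_Spaces.linear f \<Longrightarrow> finitely_spanned V \<Longrightarrow> finitely_spanned (f ` V)"
  by (metis finitely_spanned_def finite_imageI linear_span_image)

text \<open>A field is the sum of its components placed on the coordinate axes, and placing a function
  on an axis is linear. Used once this gives vector fields, used twice matrix fields.\<close>

lemma finitely_spanned_components:
  fixes V :: "('a \<Rightarrow> 'b::real_vector) set"
  assumes "finitely_spanned V"
  shows "finitely_spanned {v :: 'a \<Rightarrow> 'b^'n. \<forall>i. (\<lambda>x. v x $ i) \<in> V}" (is "finitely_spanned ?W")
proof -
  obtain S where S: "finite S" "V = span S" using assms by (auto simp: finitely_spanned_def)
  define emb :: "'n \<Rightarrow> ('a \<Rightarrow> 'b) \<Rightarrow> 'a \<Rightarrow> 'b^'n" where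
    "emb i f = (\<lambda>x. \<chi> j. if j = i then f x else 0)" for i f
  have lin: "Real_Vector_Spaces.linear (emb i)" for i
    by (rule linearI) (auto simp: emb_def fun_eq_iff vec_eq_iff)
  have comp: "(\<lambda>x. emb i f x $ j) = (if j = i then f else 0)" for i j f
    by (auto simp: emb_def fun_eq_iff)
  have sub: "subspace ?W"
  proof (rule subspaceI)
    show "0 \<in> ?W" using span_zero[of S] by (auto simp: S(2) zero_fun_def)
    show "v + w \<in> ?W" if "v \<in> ?W" "w \<in> ?W" for v w
      using that span_add[of "\<lambda>x. v x $ i" S "\<lambda>x. w x $ i" for i] by (auto simp: S(2) plus_fun_def)
    show "c *\<^sub>R v \<in> ?W" if "v \<in> ?W" for c v
      using that span_scale[of "\<lambda>x. v x $ i" S c for i] by (auto simp: S(2) scaleR_fun_def)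
  qed
  have "?W = span (\<Union>i. emb i ` S)"
  proof
    show "span (\<Union>i. emb i ` S) \<subseteq> ?W"
      by (rule span_minimal[OF _ sub]) (auto simp: comp S(2) span_base span_zero)
    show "?W \<subseteq> span (\<Union>i. emb i ` S)"
    proof
      fix v assume v: "v \<in> ?W"
      have "v = (\<Sum>i\<in>UNIV. emb i (\<lambda>x. v x $ i))"
      proof
        fix x
        have *: "(\<Sum>i\<in>A. emb i (\<lambda>x. v x $ i)) x = (\<Sum>i\<in>A. emb i (\<lambda>x. v x $ i) x)" for A :: "'n set"
          by (induction A rule: infinite_finite_induct) auto
        show "v x = (\<Sum>i\<in>UNIV. emb i (\<lambda>x. v x $ i)) x"
          unfolding * by (simp add: vec_eq_iff emb_def)
      qed
      also have "\<dots> \<in> span (\<Union>i. emb i ` S)"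
      proof (rule span_sum)
        fix i
        have "emb i (\<lambda>x. v x $ i) \<in> span (emb i ` S)"
          using v by (auto simp: linear_span_image[OF lin] S(2))
        then show "emb i (\<lambda>x. v x $ i) \<in> span (\<Union>i. emb i ` S)"
          by (meson UN_upper UNIV_I span_mono subsetD)
      qed
      finally show "v \<in> span (\<Union>i. emb i ` S)" .
    qed
  qed
  moreover have "finite (\<Union>i. emb i ` S)" using S(1) by simp
  ultimately show ?thesis unfolding finitely_spanned_def by blast
qed

lemma finite_multi_indices: "finite {\<alpha> :: 'i::finite \<Rightarrow> nat. (\<Sum>i\<in>UNIV. \<alpha> i) \<le> r}"
proof (rule finite_subset)
  show "{\<alpha> :: 'i \<Rightarrow> nat. (\<Sum>i\<in>UNIV. \<alpha> i) \<le> r} \<subseteq> PiE UNIV (\<lambda>_. {..r})"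
  proof (intro subsetI PiE_I; simp)
    fix \<alpha> :: "'i \<Rightarrow> nat" and i
    assume "(\<Sum>i\<in>UNIV. \<alpha> i) \<le> r"
    with member_le_sum[of i UNIV \<alpha>] show "\<alpha> i \<le> r" by simp
  qed
qed (simp add: finite_PiE)

lemma finitely_spanned_Pol: "finitely_spanned (Pol r :: (real^'d \<Rightarrow> real) set)"
proof -
  define I where "I = {\<alpha> :: 'd \<Rightarrow> nat. (\<Sum>i\<in>UNIV. \<alpha> i) \<le> r}"
  define m :: "('d \<Rightarrow> nat) \<Rightarrow> real^'d \<Rightarrow> real" where "m \<alpha> = (\<lambda>x. \<Prod>i\<in>UNIV. (x $ i) ^ \<alpha> i)" for \<alpha>
  have fin: "finite I" unfolding I_def by (rule finite_multi_indices)
  have eval: "(\<Sum>\<alpha>\<in>A. c \<alpha> *\<^sub>R m \<alpha>) = (\<lambda>x. \<Sum>\<alpha>\<in>A. c \<alpha> * m \<alpha> x)" for A c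
    by (induction A rule: infinite_finite_induct) (auto simp: fun_eq_iff)
  have Pol: "Pol r = range (\<lambda>c. \<Sum>\<alpha>\<in>I. c \<alpha> *\<^sub>R m \<alpha>)"
    unfolding Pol_def eval by (auto simp: I_def m_def)
  have "Pol r = span (m ` I)"
  proof
    show "Pol r \<subseteq> span (m ` I)"
      unfolding Pol by (auto intro!: span_sum span_scale intro: span_base)
    show "span (m ` I) \<subseteq> Pol r"
    proof (rule span_minimal)
      show "m ` I \<subseteq> Pol r"
      proof clarify
        fix \<alpha> assume "\<alpha> \<in> I"
        then have "m \<alpha> = (\<Sum>\<beta>\<in>I. (if \<beta> = \<alpha> then 1 else 0) *\<^sub>R m \<beta>)"
          using fin by (simp add: if_distrib[of "\<lambda>t. t *\<^sub>R _"] cong: if_cong)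
        then show "m \<alpha> \<in> Pol r" unfolding Pol
          by (rule range_eqI[of _ "\<lambda>c. \<Sum>\<alpha>\<in>I. c \<alpha> *\<^sub>R m \<alpha>" "\<lambda>\<beta>. if \<beta> = \<alpha> then 1 else 0"])
      qed
      show "subspace (Pol r :: (real^'d \<Rightarrow> real) set)"
      proof -
        have "Real_Vector_Spaces.linear (\<lambda>c. \<Sum>\<alpha>\<in>I. c \<alpha> *\<^sub>R m \<alpha>)"
          by (rule linearI) (simp_all add: scaleR_add_left sum.distrib scaleR_sum_right)
        then show ?thesis unfolding Pol by (rule linear_subspace_image) simp
      qed
    qed
  qed
  with fin show ?thesis unfolding finitely_spanned_def by blast
qed

lemma finitely_spanned_PolV: "finitely_spanned (PolV r)"
  unfolding PolV_def by (rule finitely_spanned_components[OF finitely_spanned_Pol])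

lemma finitely_spanned_PolM: "finitely_spanned (PolM r)"
  using finitely_spanned_components[OF finitely_spanned_PolV] by (simp add: PolM_def PolV_def)

text \<open>Extension by zero from the face is a linear image of the space of polynomial vector fields.\<close>

lemma finitely_spanned_PolF: "finitely_spanned (PolF r e)"
proof -
  have "PolF r e = (\<lambda>p x. if x \<in> e then p x else 0) ` PolV r"
    by (auto simp: PolF_def)
  moreover have "Real_Vector_Spaces.linear (\<lambda>p x. if x \<in> e then p x else (0::real^'a))"
    by (rule linearI) (auto simp: fun_eq_iff)
  ultimately show ?thesis using finitely_spanned_linear_image[OF _ finitely_spanned_PolV] by auto
qed

section \<open>Derivatives of polynomials\<close>

text \<open>The derivatives of polynomials enter under integrals, so their continuity is needed. It is
  obtained from closure properties of this class rather than from a formula for the derivative.\<close>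

definition continuously_differentiable :: "('a::real_normed_vector \<Rightarrow> real) \<Rightarrow> bool" where
  "continuously_differentiable f \<longleftrightarrow>
     (\<exists>f'. (\<forall>x. (f has_derivative f' x) (at x)) \<and> (\<forall>v. continuous_on UNIV (\<lambda>x. f' x v)))"

lemma continuously_differentiable_imp_continuous:
  "continuously_differentiable f \<Longrightarrow> continuous_on UNIV f"
  unfolding continuously_differentiable_def
  by (meson has_derivative_continuous continuous_at_imp_continuous_on)

lemma continuously_differentiable_const: "continuously_differentiable (\<lambda>x. c)"
  unfolding continuously_differentiable_def by (rule exI[of _ "\<lambda>x v. 0"]) auto

lemma continuously_differentiable_component: "continuously_differentiable (\<lambda>x::real^'d. x $ i)"
  unfolding continuously_differentiable_def
  by (rule exI[of _ "\<lambda>x v. v $ i"]) (auto intro!: derivative_eq_intros bounded_linear_imp_has_derivative bounded_linear_vec_nth)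

lemma continuously_differentiable_add:
  assumes "continuously_differentiable f" "continuously_differentiable g"
  shows "continuously_differentiable (\<lambda>x. f x + g x)"
proof -
  obtain f' g' where "\<And>x. (f has_derivative f' x) (at x)" "\<And>x. (g has_derivative g' x) (at x)"
    "\<And>v. continuous_on UNIV (\<lambda>x. f' x v)" "\<And>v. continuous_on UNIV (\<lambda>x. g' x v)"
    using assms unfolding continuously_differentiable_def by blast
  then show ?thesis unfolding continuously_differentiable_def
    by (intro exI[of _ "\<lambda>x v. f' x v + g' x v"]) (auto intro!: has_derivative_add continuous_intros)
qed

lemma continuously_differentiable_mult:
  assumes "continuously_differentiable f" "continuously_differentiable g"
  shows "continuously_differentiable (\<lambda>x. f x * g x)"
proof -
  obtain f' g' where "\<And>x. (f has_derivative f' x) (at x)" "\<And>x. (g has_derivative g' x) (at x)"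
    "\<And>v. continuous_on UNIV (\<lambda>x. f' x v)" "\<And>v. continuous_on UNIV (\<lambda>x. g' x v)"
    using assms unfolding continuously_differentiable_def by blast
  moreover have "continuous_on UNIV f" "continuous_on UNIV g"
    using assms by (simp_all add: continuously_differentiable_imp_continuous)
  ultimately show ?thesis unfolding continuously_differentiable_def
    by (intro exI[of _ "\<lambda>x v. f x * g' x v + f' x v * g x"]) (auto intro!: has_derivative_mult continuous_intros)
qed

lemma continuously_differentiable_power:
  "continuously_differentiable f \<Longrightarrow> continuously_differentiable (\<lambda>x. f x ^ n)"
  by (induction n) (simp_all add: continuously_differentiable_const continuously_differentiable_mult)

lemma continuously_differentiable_prod:
  "(\<And>i. i \<in> I \<Longrightarrow> continuously_differentiable (f i)) \<Longrightarrow> continuously_differentiable (\<lambda>x. \<Prod>i\<in>I. f i x)"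
  by (induction I rule: infinite_finite_induct)
     (simp_all add: continuously_differentiable_const continuously_differentiable_mult)

lemma continuously_differentiable_sum:
  "(\<And>i. i \<in> I \<Longrightarrow> continuously_differentiable (f i)) \<Longrightarrow> continuously_differentiable (\<lambda>x. \<Sum>i\<in>I. f i x)"
  by (induction I rule: infinite_finite_induct)
     (simp_all add: continuously_differentiable_const continuously_differentiable_add)

lemma Pol_continuously_differentiable: "p \<in> Pol r \<Longrightarrow> continuously_differentiable p"
  unfolding Pol_def
  by (auto intro!: continuously_differentiable_sum continuously_differentiable_prod
      continuously_differentiable_mult continuously_differentiable_const
      continuously_differentiable_power continuously_differentiable_component)

lemma continuously_differentiable_differentiable:
  "continuously_differentiable f \<Longrightarrow> f differentiable at x"
  unfolding continuously_differentiable_def differentiable_def by blast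

lemma continuously_differentiable_continuous_derivative:
  assumes "continuously_differentiable f"
  shows "continuous_on A (\<lambda>x. frechet_derivative f (at x) v)"
proof -
  obtain f' where f': "\<And>x. (f has_derivative f' x) (at x)" "\<And>v. continuous_on UNIV (\<lambda>x. f' x v)"
    using assms unfolding continuously_differentiable_def by blast
  have "frechet_derivative f (at x) = f' x" for x
    using frechet_derivative_at[OF f'(1)] by simp
  with f'(2)[of v] show ?thesis by (auto intro: continuous_on_subset)
qed

section \<open>Integrals of continuous functions over cells and faces\<close>

lemma ip_cong:
  "(\<And>x. x \<in> S \<Longrightarrow> f x = f' x) \<Longrightarrow> (\<And>x. x \<in> S \<Longrightarrow> g x = g' x) \<Longrightarrow> ip M S f g = ip M S f' g'"
  unfolding ip_def set_lebesgue_integral_def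
  by (intro Bochner_Integration.integral_cong refl) (auto simp: indicator_def)

lemma ip_commute: "ip M S f g = ip M S g f"
  by (simp add: ip_def inner_commute)

lemma ip_zero_left: "(\<And>x. x \<in> S \<Longrightarrow> f x = 0) \<Longrightarrow> ip M S f g = 0"
  using ip_cong[of S f "\<lambda>x. 0" g g M] by (simp add: ip_def set_lebesgue_integral_def)

lemma ip_zero_right: "(\<And>x. x \<in> S \<Longrightarrow> g x = 0) \<Longrightarrow> ip M S f g = 0"
  by (metis ip_commute ip_zero_left)

lemma ip_nonneg: "0 \<le> ip M S f f"
  unfolding ip_def set_lebesgue_integral_def by (intro Bochner_Integration.integral_nonneg) simp

text \<open>Cells with Lebesgue measure and faces with surface measure are used through these
  properties only. Finite measure of the bounded set \<open>S\<close> makes functions continuous on its closure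
  integrable. The last property says that \<open>S\<close> lies in the support of the restricted
  measure; it is what makes the \<open>L\<^sup>2\<close> product of continuous functions definite.\<close>

locale L2_domain =
  fixes M :: "'a::euclidean_space measure" and S :: "'a set"
  assumes space_M: "space M = UNIV"
    and borel_sets: "sets borel \<subseteq> sets M"
    and S_borel: "S \<in> sets borel"
    and S_bounded: "bounded S"
    and finite_measure_S: "emeasure M S < \<infinity>"
    and positive: "x \<in> S \<Longrightarrow> 0 < r \<Longrightarrow> emeasure M (S \<inter> ball x r) \<noteq> 0"
begin

lemma continuous_set_integrable:
  fixes f :: "'a \<Rightarrow> real"
  assumes f: "continuous_on (closure S) f"
  shows "set_integrable M S f"
proof -
  define h where "h x = indicator (closure S) x *\<^sub>R f x" for x
  have K: "compact (closure S)" using S_bounded by (simp add: compact_closure)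
  have "h \<in> borel_measurable borel" unfolding h_def
    using f by (intro borel_measurable_continuous_on_indicator) auto
  then have h: "h \<in> borel_measurable M"
    using borel_measurable_subalgebra[OF borel_sets] space_M by auto
  obtain C where C: "\<And>x. x \<in> closure S \<Longrightarrow> norm (f x) \<le> C"
    using compact_imp_bounded[OF compact_continuous_image[OF f K]] by (auto simp: bounded_iff)
  have int: "integrable M (\<lambda>x. indicator S x *\<^sub>R h x)"
  proof (rule integrableI_bounded_set_indicator[where B = C])
    show "AE x in M. x \<in> S \<longrightarrow> norm (h x) \<le> C"
      using C closure_subset[of S] by (intro AE_I2) (auto simp: h_def indicator_def)
  qed (use S_borel borel_sets finite_measure_S h in auto)
  have "indicator S x *\<^sub>R h x = indicator S x *\<^sub>R f x" for x
    using closure_subset[of S] by (auto simp: h_def indicator_def)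
  then show ?thesis
    unfolding set_integrable_def
    by (intro Bochner_Integration.integrable_cong[THEN iffD1, OF refl _ int]) blast
qed

abbreviation continuous_functions :: "('a \<Rightarrow> 'b::real_inner) set" where
  "continuous_functions \<equiv> {f. continuous_on (closure S) f}"

lemma ip_add_left:
  assumes "continuous_on (closure S) f" "continuous_on (closure S) f'" "continuous_on (closure S) g"
  shows "ip M S (f + f') g = ip M S f g + ip M S f' g"
  using assms unfolding ip_def
  by (simp add: inner_add_left continuous_set_integrable continuous_on_inner flip: set_integral_add(2))

lemma ip_scale_left: "ip M S (c *\<^sub>R f) g = c * ip M S f g"
  by (simp add: ip_def)

lemma linear_functional_on_ip:
  assumes "continuous_on (closure S) g"
  shows "linear_functional_on continuous_functions (\<lambda>f. ip M S f g)"
  using assms by (simp add: linear_functional_on_def ip_add_left ip_scale_left)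

sublocale semi_inner_product continuous_functions "ip M S"
proof
  show "subspace continuous_functions"
    by (rule subspaceI) (auto simp: zero_fun_def plus_fun_def scaleR_fun_def intro!: continuous_intros)
qed (auto simp: linear_functional_on_ip ip_nonneg intro: ip_commute)

text \<open>A continuous function that is nonzero at a point of \<open>S\<close> is nonzero on a neighbourhood in \<open>S\<close>,
  which has positive measure; from \<open>S\<close> the zero passes to the closure by continuity.\<close>

lemma ip_self_eq_0:
  assumes f: "continuous_on (closure S) f" and null: "ip M S f f = 0" and x: "x \<in> closure S"
  shows "f x = 0"
proof -
  have int: "integrable M (\<lambda>x. indicator S x *\<^sub>R (f x \<bullet> f x))"
    using continuous_set_integrable[OF continuous_on_inner[OF f f]] by (simp add: set_integrable_def)
  have ae: "AE x in M. indicator S x *\<^sub>R (f x \<bullet> f x) = 0"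
    using null integral_nonneg_eq_0_iff_AE[OF int] by (simp add: ip_def set_lebesgue_integral_def)
  have "f y = 0" if y: "y \<in> S" for y
  proof (rule ccontr)
    assume ne: "f y \<noteq> 0"
    have "continuous_on S f" using f closure_subset continuous_on_subset by blast
    moreover have "0 < norm (f y)" using ne by simp
    ultimately have "\<exists>r>0. \<forall>z\<in>S. dist z y < r \<longrightarrow> dist (f z) (f y) < norm (f y)"
      using y by (simp only: continuous_on_iff)
    then obtain r where r: "r > 0" "\<And>z. z \<in> S \<Longrightarrow> dist z y < r \<Longrightarrow> dist (f z) (f y) < norm (f y)"
      by blast
    have nz: "f z \<noteq> 0" if "z \<in> S \<inter> ball y r" for z
      using r(2)[of z] that by (auto simp: dist_commute)
    have imp: "z \<notin> S \<inter> ball y r" if "indicator S z *\<^sub>R (f z \<bullet> f z) = 0" for z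
      using that nz[of z] by (cases "z \<in> S") auto
    have "AE z in M. z \<notin> S \<inter> ball y r"
      by (rule eventually_mono[OF ae]) (rule imp)
    moreover have "S \<inter> ball y r \<in> sets M"
      by (rule subsetD[OF borel_sets sets.Int[OF S_borel]]) simp
    ultimately have "S \<inter> ball y r \<in> null_sets M"
      by (subst AE_iff_null_sets)
    then have "emeasure M (S \<inter> ball y r) = 0" by (rule null_setsD1)
    with positive[OF y r(1)] show False by simp
  qed
  then show ?thesis
    using continuous_constant_on_closure[OF f _ x] by blast
qed

lemma linear_functional_on_ip_comp:
  assumes g: "continuous_on (closure S) g"
    and L: "\<And>v. v \<in> V \<Longrightarrow> continuous_on (closure S) (L v)"
    and add: "\<And>v w x. v \<in> V \<Longrightarrow> w \<in> V \<Longrightarrow> x \<in> S \<Longrightarrow> L (v + w) x = L v x + L w x"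
    and scale: "\<And>c v x. v \<in> V \<Longrightarrow> x \<in> S \<Longrightarrow> L (c *\<^sub>R v) x = c *\<^sub>R L v x"
  shows "linear_functional_on V (\<lambda>v. ip M S (L v) g)"
  unfolding linear_functional_on_def
proof (intro conjI ballI allI)
  fix v w assume v: "v \<in> V" and w: "w \<in> V"
  have "ip M S (L (v + w)) g = ip M S (L v + L w) g"
    by (rule ip_cong) (simp_all add: add v w)
  then show "ip M S (L (v + w)) g = ip M S (L v) g + ip M S (L w) g"
    by (simp add: ip_add_left L v w g)
next
  fix c v assume v: "v \<in> V"
  have "ip M S (L (c *\<^sub>R v)) g = ip M S (c *\<^sub>R L v) g"
    by (rule ip_cong) (simp_all add: scale v)
  then show "ip M S (L (c *\<^sub>R v)) g = c * ip M S (L v) g" by (simp add: ip_scale_left)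
qed

text \<open>Null vectors are exactly the functions vanishing on the closure of \<open>S\<close>, so it suffices that
  \<open>l\<close> depends on the values there.\<close>

lemma riesz_continuous:
  assumes V: "finitely_spanned V" "V \<subseteq> continuous_functions" and l: "linear_functional_on V l"
    and null: "\<And>v. v \<in> V \<Longrightarrow> (\<And>x. x \<in> closure S \<Longrightarrow> v x = 0) \<Longrightarrow> l v = 0"
  shows "\<exists>p\<in>V. \<forall>v\<in>V. ip M S p v = l v"
proof -
  obtain A where A: "finite A" "V = span A" using V(1) by (auto simp: finitely_spanned_def)
  interpret V: semi_inner_product V "ip M S"
  proof
    show "subspace V" by (rule finitely_spanned_subspace[OF V(1)])
    show "linear_functional_on V (\<lambda>x. ip M S x y)" if "y \<in> V" for y
      using linear_functional_on_subset[OF linear V(2)] that V(2) by blast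
  qed (rule ip_commute, rule ip_nonneg)
  show ?thesis
  proof (rule V.riesz[OF A(1) _ l, folded A(2)])
    show "A \<subseteq> V" unfolding A(2) by (rule span_superset)
    show "l v = 0" if v: "v \<in> V" "ip M S v v = 0" for v
    proof (rule null[OF v(1)])
      show "v x = 0" if "x \<in> closure S" for x
        using ip_self_eq_0[OF _ v(2) that] v(1) V(2) by blast
    qed
  qed
qed

end

section \<open>Cells and faces as integration domains\<close>

lemma L2_domain_cell:
  assumes T: "polyhedral_domain T"
  shows "L2_domain lebesgue T"
proof
  have "open T" using T by (simp add: polyhedral_domain_def)
  then show "T \<in> sets borel" by simp
  have "\<exists>\<P>. finite \<P> \<and> (\<forall>P\<in>\<P>. polytope P) \<and> closure T = \<Union>\<P>"
    using T by (simp add: polyhedral_domain_def)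
  then obtain \<P> where P: "finite \<P>" "\<And>P. P \<in> \<P> \<Longrightarrow> polytope P" "closure T = \<Union>\<P>"
    by (elim exE conjE) blast
  have "compact (closure T)"
    unfolding P(3) by (intro compact_Union P(1) polytope_imp_compact P(2))
  then show b: "bounded T" by (meson bounded_subset closure_subset compact_imp_bounded)
  show "emeasure lebesgue T < \<infinity>"
    using b \<open>open T\<close> emeasure_bounded_finite[OF b] by auto
  show "emeasure lebesgue (T \<inter> ball x r) \<noteq> 0" if "x \<in> T" "0 < r" for x r
  proof
    assume "emeasure lebesgue (T \<inter> ball x r) = 0"
    then have "negligible (T \<inter> ball x r)"
      using \<open>open T\<close> by (auto simp: negligible_iff_null_sets intro: null_setsI)
    then have "T \<inter> ball x r = {}"
      using open_not_negligible[of "T \<inter> ball x r"] \<open>open T\<close> open_Int[OF _ open_ball] by metis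
    with that show False by auto
  qed
qed auto


text \<open>A flat face has codimension one, so it lies in a hyperplane and the choice in the definition of
  the surface measure returns such a hyperplane. On Borel sets the measure is the volume
  of the preimage in the slab, and this is the only description used later.\<close>

lemma surf_eq_slab_measure:
  assumes "flat_face e"
  obtains n c where "norm n = 1" "e \<subseteq> {x. n \<bullet> x = c}" "space (surf e) = UNIV"
    "sets borel \<subseteq> sets (surf e)"
    "\<And>A. A \<in> sets borel \<Longrightarrow> emeasure (surf e) A =
       emeasure lborel ({x. c \<le> n \<bullet> x \<and> n \<bullet> x \<le> c + 1} \<inter> (\<lambda>x. x - (n \<bullet> x - c) *\<^sub>R n) -` A)"
proof -
  have "aff_dim e = DIM(real^'a) - 1" using assms by (simp add: flat_face_def)
  then obtain a b where ab: "a \<noteq> 0" "affine hull e = {x. a \<bullet> x = b}"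
    using aff_dim_eq_hyperplane by blast
  have "e \<subseteq> {x. (a /\<^sub>R norm a) \<bullet> x = b / norm a}"
    using ab hull_subset[of e affine] by (auto simp: divide_inverse mult.commute)
  moreover have "norm (a /\<^sub>R norm a) = 1" using ab by simp
  ultimately have ex: "\<exists>p. case p of (n, c) \<Rightarrow> norm n = 1 \<and> e \<subseteq> {x. n \<bullet> x = c}"
    by (intro exI[of _ "(a /\<^sub>R norm a, b / norm a)"]) simp
  obtain n c where nc: "(SOME (n, c). norm n = 1 \<and> e \<subseteq> {x. n \<bullet> x = c}) = (n, c)"
    by (meson surj_pair)
  have nc': "norm n = 1" "e \<subseteq> {x. n \<bullet> x = c}"
    using someI_ex[OF ex] unfolding nc by auto
  define R where "R = {x. c \<le> n \<bullet> x \<and> n \<bullet> x \<le> c + 1}"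
  define P where "P x = x - (n \<bullet> x - c) *\<^sub>R n" for x
  define D where "D = distr (restrict_space lborel R) borel P"
  have surf: "surf e = completion D"
    unfolding surf_def nc D_def R_def P_def by simp
  have R: "R \<in> sets borel" unfolding R_def by measurable
  have P: "P \<in> borel_measurable borel"
    unfolding P_def by (intro borel_measurable_continuous_onI continuous_intros)
  then have P': "P \<in> borel_measurable (restrict_space lborel R)"
    by (simp add: measurable_restrict_space1)
  have meas: "emeasure (surf e) A = emeasure lborel (R \<inter> P -` A)" if A: "A \<in> sets borel" for A
  proof -
    have "emeasure (surf e) A = emeasure D A"
      unfolding surf using A by (simp add: D_def)
    also have "\<dots> = emeasure (restrict_space lborel R) (P -` A \<inter> R)"
      unfolding D_def using A P' by (simp add: emeasure_distr space_restrict_space)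
    also have "\<dots> = emeasure lborel (P -` A \<inter> R)"
      using R by (intro emeasure_restrict_space) auto
    finally show ?thesis by (simp add: Int_commute)
  qed
  show ?thesis
  proof (rule that[OF nc'])
    show "space (surf e) = UNIV" by (simp add: surf D_def)
    show "sets borel \<subseteq> sets (surf e)" by (auto simp: surf D_def intro: sets_completionI_sets)
  qed (use meas in \<open>simp add: R_def P_def[abs_def]\<close>)
qed

lemma flat_face_compact: "flat_face e \<Longrightarrow> compact e"
  unfolding flat_face_def by (metis compact_Union polytope_imp_compact)

text \<open>The preimage of the face in the slab is bounded because the projection moves a point of the slab
  by at most one. For positivity, every point \<open>x\<close> of the face is a limit of relative
  interior points \<open>y\<close> of a polytope piece, whose affine hull is the whole hyperplane. The
  projection is nonexpansive, so a small ball centred just above \<open>y\<close> in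
  the slab projects into the face and close to \<open>x\<close>.\<close>

lemma L2_domain_face:
  assumes e: "flat_face (e :: (real^'d) set)"
  shows "L2_domain (surf e) e"
proof -
  obtain n c where nc: "norm n = 1" "e \<subseteq> {x. n \<bullet> x = c}" "space (surf e) = UNIV"
    "sets borel \<subseteq> sets (surf e)"
    and meas: "\<And>A. A \<in> sets borel \<Longrightarrow> emeasure (surf e) A =
       emeasure lborel ({x. c \<le> n \<bullet> x \<and> n \<bullet> x \<le> c + 1} \<inter> (\<lambda>x. x - (n \<bullet> x - c) *\<^sub>R n) -` A)"
    by (rule surf_eq_slab_measure[OF e]) (rule that)
  let ?R = "{x. c \<le> n \<bullet> x \<and> n \<bullet> x \<le> c + 1}"
  let ?P = "\<lambda>x. x - (n \<bullet> x - c) *\<^sub>R n"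
  have cpt: "compact e" by (rule flat_face_compact[OF e])
  have borel: "e \<in> sets borel" using cpt by (simp add: compact_imp_closed)
  have n1: "n \<bullet> n = 1" using nc(1) by (simp add: norm_eq_1)
  have n0: "n \<noteq> 0" using nc(1) by auto
  show ?thesis
  proof
    show "space (surf e) = UNIV" "sets borel \<subseteq> sets (surf e)" "e \<in> sets borel"
      by (fact nc borel)+
    show b: "bounded e" by (rule compact_imp_bounded[OF cpt])
    obtain C where C: "\<And>x. x \<in> e \<Longrightarrow> norm x \<le> C" using b by (auto simp: bounded_iff)
    have "norm x \<le> C + 1" if "x \<in> ?R \<inter> ?P -` e" for x
    proof -
      have "norm x = norm (?P x + (n \<bullet> x - c) *\<^sub>R n)" by simp
      also have "\<dots> \<le> norm (?P x) + norm ((n \<bullet> x - c) *\<^sub>R n)" by (rule norm_triangle_ineq)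
      also have "\<dots> \<le> C + 1" using that C[of "?P x"] nc(1) by (intro add_mono) auto
      finally show ?thesis .
    qed
    then have "bounded (?R \<inter> ?P -` e)" by (auto simp: bounded_iff)
    then show "emeasure (surf e) e < \<infinity>"
      unfolding meas[OF borel] by (rule emeasure_bounded_finite)
    show "emeasure (surf e) (e \<inter> ball x r) \<noteq> 0" if x: "x \<in> e" and r: "0 < r" for x r
    proof
      assume null: "emeasure (surf e) (e \<inter> ball x r) = 0"
      obtain Q where Q: "polytope Q" "aff_dim Q = int CARD('d) - 1" "x \<in> Q" "Q \<subseteq> e"
        using e x unfolding flat_face_def by blast
      have "x \<in> closure (rel_interior Q)"
        using Q(1,3) by (metis convex_closure_rel_interior polytope_imp_convex closure_subset subsetD)
      then obtain y where y: "y \<in> rel_interior Q" "dist y x < r"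
        using r by (auto simp: closure_approachable)
      have hull: "affine hull Q = {x. n \<bullet> x = c}"
      proof (rule affine_dim_equal)
        show "affine hull Q \<subseteq> {x. n \<bullet> x = c}"
          using Q(4) nc(2) by (intro hull_minimal) (auto simp: affine_hyperplane)
        show "aff_dim (affine hull Q) = aff_dim {x. n \<bullet> x = c}"
          using n0 Q(2) by (simp add: aff_dim_hyperplane)
      qed (use Q(3) in \<open>auto simp: affine_hyperplane\<close>)
      obtain \<epsilon> where \<epsilon>: "\<epsilon> > 0" "ball y \<epsilon> \<inter> affine hull Q \<subseteq> Q" and yQ: "y \<in> Q"
        using y(1) by (auto simp: mem_rel_interior_ball)
      have ny: "n \<bullet> y = c" using yQ Q(4) nc(2) by auto
      \<comment> \<open>The ball of radius \<open>t\<close> about \<open>y + t n\<close> has heights between \<open>0\<close> and \<open>2 t\<close>, hence stays in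
        the slab if \<open>2 t \<le> 1\<close>; its projection stays within \<open>t\<close> of \<open>y\<close>.\<close>
      define t where "t = min (1/2) (min \<epsilon> (r - dist y x))"
      have t: "t > 0" "t \<le> 1/2" "t \<le> \<epsilon>" "t \<le> r - dist y x" using \<epsilon>(1) y(2) unfolding t_def by linarith+
      have sub: "ball (y + t *\<^sub>R n) t \<subseteq> ?R \<inter> ?P -` (e \<inter> ball x r)"
      proof
        fix z assume "z \<in> ball (y + t *\<^sub>R n) t"
        define w where "w = z - (y + t *\<^sub>R n)"
        have w: "norm w < t"
          using \<open>z \<in> _\<close> by (simp add: w_def dist_norm norm_minus_commute)
        have z: "z = y + t *\<^sub>R n + w" by (simp add: w_def)
        have nw: "\<bar>n \<bullet> w\<bar> < t" using Cauchy_Schwarz_ineq2[of n w] nc(1) w by simp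
        have nz: "n \<bullet> z - c = t + n \<bullet> w" by (simp add: z inner_add_right n1 ny)
        have Pz: "?P z = y + (w - (n \<bullet> w) *\<^sub>R n)" unfolding nz by (simp add: z algebra_simps)
        have "(norm (w - (n \<bullet> w) *\<^sub>R n))\<^sup>2 = (norm w)\<^sup>2 - (n \<bullet> w)\<^sup>2"
          unfolding power2_norm_eq_inner
          by (simp add: inner_diff_left inner_diff_right n1 inner_commute power2_eq_square)
        then have "(norm (w - (n \<bullet> w) *\<^sub>R n))\<^sup>2 \<le> (norm w)\<^sup>2" by simp
        then have "norm (w - (n \<bullet> w) *\<^sub>R n) \<le> norm w" by (rule power2_le_imp_le) simp
        then have d: "dist y (?P z) < t" using w unfolding Pz by (simp add: dist_norm norm_minus_commute)
        have "?P z \<in> affine hull Q"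
          unfolding hull by (simp add: inner_diff_right n1)
        moreover have "?P z \<in> ball y \<epsilon>" using d t(3) unfolding mem_ball by linarith
        ultimately have "?P z \<in> e" using \<epsilon>(2) Q(4) by blast
        moreover have "dist x (?P z) < r"
          using d t(4) dist_triangle[of x "?P z" y] dist_commute[of x y] by linarith
        moreover have "z \<in> ?R" using nz nw t by auto
        ultimately show "z \<in> ?R \<inter> ?P -` (e \<inter> ball x r)" by auto
      qed
      have "?R \<inter> ?P -` (e \<inter> ball x r) \<in> sets lborel"
      proof -
        have "?P \<in> borel_measurable borel"
          by (intro borel_measurable_continuous_onI continuous_intros)
        then have "?P -` (e \<inter> ball x r) \<in> sets borel"
          using measurable_sets[of ?P borel borel "e \<inter> ball x r"] borel by simp
        moreover have "?R \<in> sets borel" by measurable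
        ultimately show ?thesis by auto
      qed
      then have "emeasure lborel (ball (y + t *\<^sub>R n) t) = 0"
        using null emeasure_mono[OF sub, of lborel] meas[of "e \<inter> ball x r"] borel by auto
      then have "ball (y + t *\<^sub>R n) t \<in> null_sets lborel" by (auto intro: null_setsI)
      then have "negligible (ball (y + t *\<^sub>R n) t)"
        by (simp add: negligible_iff_null_sets null_sets_completionI)
      then show False
        using open_not_negligible[of "ball (y + t *\<^sub>R n) t"] t(1) by auto
    qed
  qed
qed

section \<open>Traces and derivatives of polynomial fields\<close>

lemma continuous_on_vec_components:
  "(\<And>i. continuous_on A (\<lambda>x. f x $ i)) \<Longrightarrow> continuous_on A f"
  using continuous_on_vec_lambda[of A "\<lambda>i x. f x $ i"] by simp

lemma Pol_continuous: "p \<in> Pol r \<Longrightarrow> continuous_on A p"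
  by (metis Pol_continuously_differentiable continuously_differentiable_imp_continuous
      continuous_on_subset subset_UNIV)

lemma PolV_continuous: "v \<in> PolV r \<Longrightarrow> continuous_on A v"
  by (rule continuous_on_vec_components) (auto simp: PolV_def intro: Pol_continuous)

lemma PolM_continuous:
  assumes "q \<in> PolM r" shows "continuous_on A q"
proof (intro continuous_on_vec_components)
  show "continuous_on A (\<lambda>x. q x $ i $ j)" for i j
    using assms by (intro Pol_continuous[of _ r]) (simp add: PolM_def)
qed

lemma PolF_continuous: "v \<in> PolF r e \<Longrightarrow> continuous_on e v"
  unfolding PolF_def using PolV_continuous[of _ r e] by (auto cong: continuous_on_cong)

lemma PolF_outside: "v \<in> PolF r e \<Longrightarrow> x \<notin> e \<Longrightarrow> v x = 0"
  by (auto simp: PolF_def)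

lemma PolM_times_vector_continuous:
  "q \<in> PolM r \<Longrightarrow> continuous_on A (\<lambda>x. q x *v n)"
  unfolding matrix_vector_mult_def
  by (intro continuous_on_vec_lambda continuous_on_sum continuous_on_mult continuous_on_const
      Pol_continuous[where r = r]) (simp add: PolM_def)

text \<open>Vanishing on an open set passes to derivatives. This is why the functionals defining the weak
  derivatives vanish on test functions that are null on the cell.\<close>

lemma frechet_derivative_zero_on_open:
  assumes "open T" "x \<in> T" "\<And>y. y \<in> T \<Longrightarrow> f y = 0"
  shows "frechet_derivative f (at x) = (\<lambda>_. 0)"
proof -
  have "(f has_derivative (\<lambda>_. 0)) (at x)"
    by (rule has_derivative_transform_within_open[OF has_derivative_const assms(1,2)])
       (simp add: assms(3))
  then show ?thesis by (rule frechet_derivative_at[symmetric])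
qed

lemma frechet_derivative_add_Pol:
  assumes "p \<in> Pol r" "q \<in> Pol s"
  shows "frechet_derivative (\<lambda>y. p y + q y) (at x) v =
    frechet_derivative p (at x) v + frechet_derivative q (at x) v"
proof -
  have "(p has_derivative frechet_derivative p (at x)) (at x)"
    "(q has_derivative frechet_derivative q (at x)) (at x)"
    using assms Pol_continuously_differentiable continuously_differentiable_differentiable
    unfolding frechet_derivative_works[symmetric] by blast+
  from fun_cong[OF frechet_derivative_at[OF has_derivative_add[OF this]], of v]
  show ?thesis by simp
qed

lemma frechet_derivative_scale_Pol:
  assumes "p \<in> Pol r"
  shows "frechet_derivative (\<lambda>y. c * p y) (at x) v = c * frechet_derivative p (at x) v"
proof -
  have "(p has_derivative frechet_derivative p (at x)) (at x)"
    using assms Pol_continuously_differentiable continuously_differentiable_differentiable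
    unfolding frechet_derivative_works[symmetric] by blast
  from fun_cong[OF frechet_derivative_at[OF has_derivative_mult_right[OF this, of c]], of v]
  show ?thesis by simp
qed

lemma grad_continuous: "p \<in> Pol r \<Longrightarrow> continuous_on A (grad p)"
  unfolding grad_def[abs_def]
  by (intro continuous_on_vec_lambda continuously_differentiable_continuous_derivative
      Pol_continuously_differentiable)

lemma grad_add: "p \<in> Pol r \<Longrightarrow> q \<in> Pol r \<Longrightarrow> grad (p + q) x = grad p x + grad q x"
  by (simp add: grad_def vec_eq_iff plus_fun_def frechet_derivative_add_Pol[of _ r _ r])

lemma grad_scale: "p \<in> Pol r \<Longrightarrow> grad (c *\<^sub>R p) x = c *\<^sub>R grad p x"
  by (simp add: grad_def vec_eq_iff scaleR_fun_def frechet_derivative_scale_Pol[of _ r])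

lemma row_div_continuous: "q \<in> PolM r \<Longrightarrow> continuous_on A (row_div q)"
  unfolding row_div_def[abs_def]
  by (intro continuous_on_vec_lambda continuous_on_sum continuously_differentiable_continuous_derivative
      Pol_continuously_differentiable[where r = r]) (auto simp: PolM_def)

lemma row_div_add:
  "q \<in> PolM r \<Longrightarrow> q' \<in> PolM r \<Longrightarrow> row_div (q + q') x = row_div q x + row_div q' x"
  by (simp add: row_div_def vec_eq_iff PolM_def frechet_derivative_add_Pol[of _ r _ r] sum.distrib)

lemma row_div_scale: "q \<in> PolM r \<Longrightarrow> row_div (c *\<^sub>R q) x = c *\<^sub>R row_div q x"
  by (simp add: row_div_def vec_eq_iff PolM_def frechet_derivative_scale_Pol[of _ r] sum_distrib_left)

lemma grad_zero_on_open:
  "open T \<Longrightarrow> x \<in> T \<Longrightarrow> (\<And>y. y \<in> T \<Longrightarrow> p y = 0) \<Longrightarrow> grad p x = 0"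
  by (simp add: grad_def vec_eq_iff frechet_derivative_zero_on_open[of T])

lemma row_div_zero_on_open:
  "open T \<Longrightarrow> x \<in> T \<Longrightarrow> (\<And>y. y \<in> T \<Longrightarrow> q y = 0) \<Longrightarrow> row_div q x = 0"
  by (simp add: row_div_def vec_eq_iff frechet_derivative_zero_on_open[of T])

section \<open>Weak derivatives and local forms on one cell\<close>

lemma subspace_Lambda_loc: "subspace (Lambda_loc k \<E> T)"
  using finitely_spanned_subspace[OF finitely_spanned_PolF]
  by (auto simp: Lambda_loc_def subspace_def Pi_iff)

lemma subspace_V_loc: "subspace (V_loc k \<E> T)"
  unfolding V_loc_def
  by (intro subspace_Times subspace_Lambda_loc finitely_spanned_subspace finitely_spanned_PolV)

locale mesh_cell =
  fixes k :: nat and \<E> :: "(real^'d) set set" and T :: "(real^'d) set"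
  assumes polyhedral: "polyhedral_domain T"
    and finite_faces: "finite (faces \<E> T)"
    and flat: "e \<in> faces \<E> T \<Longrightarrow> flat_face e"
begin

sublocale cell: L2_domain lebesgue T
  by (rule L2_domain_cell[OF polyhedral])

lemma face_L2: "e \<in> faces \<E> T \<Longrightarrow> L2_domain (surf e) e"
  by (rule L2_domain_face[OF flat])

lemma open_T: "open T"
  using polyhedral by (simp add: polyhedral_domain_def)

lemma face_closed: "e \<in> faces \<E> T \<Longrightarrow> closure e = e"
  by (simp add: flat flat_face_compact compact_imp_closed)

lemma face_subset_closure: "e \<in> faces \<E> T \<Longrightarrow> x \<in> e \<Longrightarrow> x \<in> closure T"
  by (auto simp: faces_def frontier_def)

lemma fst_V_continuous: "v \<in> V_loc k \<E> T \<Longrightarrow> continuous_on A (fst v)"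
  by (auto simp: V_loc_def intro: PolV_continuous)

lemma snd_V_PolF: "v \<in> V_loc k \<E> T \<Longrightarrow> e \<in> faces \<E> T \<Longrightarrow> snd v e \<in> PolF (k - 1) e"
  by (auto simp: V_loc_def Lambda_loc_def)

lemma snd_V_continuous: "v \<in> V_loc k \<E> T \<Longrightarrow> e \<in> faces \<E> T \<Longrightarrow> continuous_on e (snd v e)"
  by (rule PolF_continuous[OF snd_V_PolF])

text \<open>The system for the weak gradient is the Riesz representation of its right-hand side: a test
  field vanishing on the closure of the cell has zero divergence in the cell and zero trace on the
  faces.\<close>

lemma weak_grad_properties:
  assumes v: "v \<in> V_loc k \<E> T"
  shows "weak_grad k \<E> T v \<in> PolM (k - 1) \<and> (\<forall>q\<in>PolM (k - 1).
     ip lebesgue T (weak_grad k \<E> T v) q = - ip lebesgue T (fst v) (row_div q)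
       + (\<Sum>e\<in>faces \<E> T. ip (surf e) e (snd v e) (\<lambda>x. q x *v normal T e)))"
proof -
  define l where "l q = - ip lebesgue T (fst v) (row_div q)
       + (\<Sum>e\<in>faces \<E> T. ip (surf e) e (snd v e) (\<lambda>x. q x *v normal T e))" for q
  have "\<exists>G\<in>PolM (k - 1). \<forall>q\<in>PolM (k - 1). ip lebesgue T G q = l q"
  proof (rule cell.riesz_continuous)
    show "finitely_spanned (PolM (k - 1) :: (real^'d \<Rightarrow> real^'d^'d) set)"
      by (rule finitely_spanned_PolM)
    show "PolM (k - 1) \<subseteq> cell.continuous_functions" by (auto intro: PolM_continuous)
    have 1: "linear_functional_on (PolM (k - 1)) (\<lambda>q. ip lebesgue T (fst v) (row_div q))"
      unfolding ip_commute[of lebesgue T "fst v"]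
      by (rule cell.linear_functional_on_ip_comp)
        (auto intro: fst_V_continuous v row_div_continuous row_div_add row_div_scale)
    have 2: "linear_functional_on (PolM (k - 1)) (\<lambda>q. ip (surf e) e (snd v e) (\<lambda>x. q x *v normal T e))"
      if e: "e \<in> faces \<E> T" for e
      unfolding ip_commute[of "surf e" e "snd v e"]
      by (rule L2_domain.linear_functional_on_ip_comp[OF face_L2[OF e]])
        (auto intro: snd_V_continuous v e PolM_times_vector_continuous
          simp: face_closed[OF e] matrix_vector_mult_add_rdistrib scaleR_matrix_vector_assoc)
    show "linear_functional_on (PolM (k - 1)) l"
      unfolding l_def
      by (intro linear_functional_on_add linear_functional_on_minus linear_functional_on_sum 1 2)
    show "l q = 0" if q: "q \<in> PolM (k - 1)" and null: "\<And>x. x \<in> closure T \<Longrightarrow> q x = 0" for q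
    proof -
      have "ip lebesgue T (fst v) (row_div q) = 0"
        by (rule ip_zero_right) (rule row_div_zero_on_open[OF open_T], use null closure_subset in auto)
      moreover have "ip (surf e) e (snd v e) (\<lambda>x. q x *v normal T e) = 0" if "e \<in> faces \<E> T" for e
        by (rule ip_zero_right) (simp add: null face_subset_closure[OF that])
      ultimately show ?thesis by (simp add: l_def)
    qed
  qed
  then have "\<exists>G. G \<in> PolM (k - 1) \<and> (\<forall>q\<in>PolM (k - 1).
     ip lebesgue T G q = - ip lebesgue T (fst v) (row_div q)
       + (\<Sum>e\<in>faces \<E> T. ip (surf e) e (snd v e) (\<lambda>x. q x *v normal T e)))"
    unfolding l_def by blast
  from someI_ex[OF this] show ?thesis unfolding weak_grad_def by blast
qed

lemma weak_div_properties:
  assumes v: "v \<in> V_loc k \<E> T"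
  shows "weak_div k \<E> T v \<in> Pol (k - 1) \<and> (\<forall>\<phi>\<in>Pol (k - 1).
     ip lebesgue T (weak_div k \<E> T v) \<phi> = - ip lebesgue T (fst v) (grad \<phi>)
       + (\<Sum>e\<in>faces \<E> T. ip (surf e) e (\<lambda>x. snd v e x \<bullet> normal T e) \<phi>))"
proof -
  define l where "l \<phi> = - ip lebesgue T (fst v) (grad \<phi>)
       + (\<Sum>e\<in>faces \<E> T. ip (surf e) e (\<lambda>x. snd v e x \<bullet> normal T e) \<phi>)" for \<phi>
  have "\<exists>D\<in>Pol (k - 1). \<forall>\<phi>\<in>Pol (k - 1). ip lebesgue T D \<phi> = l \<phi>"
  proof (rule cell.riesz_continuous)
    show "finitely_spanned (Pol (k - 1) :: (real^'d \<Rightarrow> real) set)"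
      by (rule finitely_spanned_Pol)
    show "Pol (k - 1) \<subseteq> cell.continuous_functions" by (auto intro: Pol_continuous)
    have 1: "linear_functional_on (Pol (k - 1)) (\<lambda>\<phi>. ip lebesgue T (fst v) (grad \<phi>))"
      unfolding ip_commute[of lebesgue T "fst v"]
      by (rule cell.linear_functional_on_ip_comp)
        (auto intro: fst_V_continuous v grad_continuous grad_add grad_scale)
    have 2: "linear_functional_on (Pol (k - 1)) (\<lambda>\<phi>. ip (surf e) e (\<lambda>x. snd v e x \<bullet> normal T e) \<phi>)"
      if e: "e \<in> faces \<E> T" for e
      unfolding ip_commute[of "surf e" e "\<lambda>x. snd v e x \<bullet> normal T e"]
      by (rule L2_domain.linear_functional_on_ip_comp[OF face_L2[OF e]])
        (auto intro: continuous_on_inner[OF snd_V_continuous[OF v e] continuous_on_const] Pol_continuous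
          simp: face_closed[OF e])
    show "linear_functional_on (Pol (k - 1)) l"
      unfolding l_def
      by (intro linear_functional_on_add linear_functional_on_minus linear_functional_on_sum 1 2)
    show "l \<phi> = 0" if q: "\<phi> \<in> Pol (k - 1)" and null: "\<And>x. x \<in> closure T \<Longrightarrow> \<phi> x = 0" for \<phi>
    proof -
      have "ip lebesgue T (fst v) (grad \<phi>) = 0"
        by (rule ip_zero_right) (rule grad_zero_on_open[OF open_T], use null closure_subset in auto)
      moreover have "ip (surf e) e (\<lambda>x. snd v e x \<bullet> normal T e) \<phi> = 0" if "e \<in> faces \<E> T" for e
        by (rule ip_zero_right) (simp add: null face_subset_closure[OF that])
      ultimately show ?thesis by (simp add: l_def)
    qed
  qed
  then have "\<exists>D. D \<in> Pol (k - 1) \<and> (\<forall>\<phi>\<in>Pol (k - 1).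
     ip lebesgue T D \<phi> = - ip lebesgue T (fst v) (grad \<phi>)
       + (\<Sum>e\<in>faces \<E> T. ip (surf e) e (\<lambda>x. snd v e x \<bullet> normal T e) \<phi>))"
    unfolding l_def by blast
  from someI_ex[OF this] show ?thesis unfolding weak_div_def by blast
qed

lemma Qb_properties:
  assumes e: "e \<in> faces \<E> T" and v: "continuous_on e v"
  shows "Qb k e v \<in> PolF (k - 1) e \<and>
    (\<forall>w\<in>PolF (k - 1) e. ip (surf e) e (Qb k e v) w = ip (surf e) e v w)"
proof -
  interpret face: L2_domain "surf e" e by (rule face_L2[OF e])
  have sub: "PolF (k - 1) e \<subseteq> face.continuous_functions"
    by (auto simp: face_closed[OF e] intro: PolF_continuous)
  have "\<exists>p\<in>PolF (k - 1) e. \<forall>w\<in>PolF (k - 1) e. ip (surf e) e p w = ip (surf e) e v w"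
  proof (rule face.riesz_continuous[OF finitely_spanned_PolF sub])
    show "linear_functional_on (PolF (k - 1) e) (\<lambda>w. ip (surf e) e v w)"
      unfolding ip_commute[of "surf e" e v]
      using v by (intro linear_functional_on_subset[OF face.linear_functional_on_ip sub])
        (simp only: face_closed[OF e])
    show "ip (surf e) e v w = 0" if "\<And>x. x \<in> closure e \<Longrightarrow> w x = 0" for w
      using that closure_subset by (intro ip_zero_right) blast
  qed
  then have "\<exists>p. p \<in> PolF (k - 1) e \<and>
      (\<forall>w\<in>PolF (k - 1) e. ip (surf e) e p w = ip (surf e) e v w)" by blast
  from someI_ex[OF this] show ?thesis unfolding Qb_def by blast
qed

text \<open>The field \<open>Q\<^sub>b v\<^sub>0 - v\<^sub>b\<close> penalized by the stabilizer.\<close>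

definition boundary_defect :: "'d weakfun \<Rightarrow> (real^'d) set \<Rightarrow> 'd vfield" where
  "boundary_defect v e = (\<lambda>x. Qb k e (fst v) x - snd v e x)"

lemma boundary_defect_PolF:
  assumes "v \<in> V_loc k \<E> T" "e \<in> faces \<E> T"
  shows "boundary_defect v e \<in> PolF (k - 1) e"
proof -
  have "Qb k e (fst v) - snd v e \<in> PolF (k - 1) e"
    using Qb_properties[OF assms(2) fst_V_continuous[OF assms(1)]] snd_V_PolF[OF assms]
    by (intro subspace_diff[OF finitely_spanned_subspace[OF finitely_spanned_PolF]]) auto
  then show ?thesis by (simp add: boundary_defect_def fun_diff_def)
qed

lemma ip_boundary_defect:
  assumes v: "v \<in> V_loc k \<E> T" and e: "e \<in> faces \<E> T" and g: "g \<in> PolF (k - 1) e"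
  shows "ip (surf e) e (boundary_defect v e) g = ip (surf e) e (\<lambda>x. fst v x - snd v e x) g"
proof -
  interpret face: L2_domain "surf e" e by (rule face_L2[OF e])
  note Q = Qb_properties[OF e fst_V_continuous[OF v]]
  have cont: "w \<in> face.continuous_functions" if "w \<in> PolF (k - 1) e" for w
    using PolF_continuous[OF that] by (simp add: face_closed[OF e])
  have fst: "fst v \<in> face.continuous_functions"
    using fst_V_continuous[OF v] by simp
  have "boundary_defect v e = Qb k e (fst v) - snd v e"
    by (simp add: boundary_defect_def fun_diff_def)
  then have "ip (surf e) e (boundary_defect v e) g
      = ip (surf e) e (Qb k e (fst v)) g - ip (surf e) e (snd v e) g"
    using Q by (simp only: face.diff_left[OF cont cont cont[OF g]] snd_V_PolF[OF v e])
  also have "\<dots> = ip (surf e) e (fst v - snd v e) g"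
    using Q g by (simp only: face.diff_left[OF fst cont[OF snd_V_PolF[OF v e]] cont[OF g]])
  finally show ?thesis by (simp add: fun_diff_def)
qed

text \<open>On the right, \<open>v\<close> no longer enters through its weak gradient or its projection, which are
  fixed only by a choice; the defining equations of both, tested with the polynomial
  fields belonging to \<open>w\<close>, remove them. The right-hand side is therefore visibly linear in \<open>v\<close>.\<close>

lemma a_loc_eq:
  assumes v: "v \<in> V_loc k \<E> T" and w: "w \<in> V_loc k \<E> T"
  shows "a_loc k \<E> T v w =
      - ip lebesgue T (fst v) (row_div (weak_grad k \<E> T w))
      + (\<Sum>e\<in>faces \<E> T. ip (surf e) e (snd v e) (\<lambda>x. weak_grad k \<E> T w x *v normal T e))
      + inverse (diameter T) *
        (\<Sum>e\<in>faces \<E> T. ip (surf e) e (\<lambda>x. fst v x - snd v e x) (boundary_defect w e))"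
  using weak_grad_properties[OF v] weak_grad_properties[OF w]
  by (simp add: a_loc_def ip_boundary_defect[OF v _ boundary_defect_PolF[OF w]]
      flip: boundary_defect_def)

lemma linear_functional_on_ip_fst:
  assumes "continuous_on (closure T) g"
  shows "linear_functional_on (V_loc k \<E> T) (\<lambda>v. ip lebesgue T (fst v) g)"
  by (rule cell.linear_functional_on_ip_comp) (auto intro: assms fst_V_continuous)

lemma linear_functional_on_a_loc:
  assumes w: "w \<in> V_loc k \<E> T"
  shows "linear_functional_on (V_loc k \<E> T) (\<lambda>v. a_loc k \<E> T v w)"
proof -
  have G: "weak_grad k \<E> T w \<in> PolM (k - 1)" using weak_grad_properties[OF w] by blast
  have 1: "linear_functional_on (V_loc k \<E> T)
     (\<lambda>v. ip lebesgue T (fst v) (row_div (weak_grad k \<E> T w)))"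
    by (rule linear_functional_on_ip_fst[OF row_div_continuous[OF G]])
  have 2: "linear_functional_on (V_loc k \<E> T)
     (\<lambda>v. ip (surf e) e (snd v e) (\<lambda>x. weak_grad k \<E> T w x *v normal T e))"
    if e: "e \<in> faces \<E> T" for e
    by (rule L2_domain.linear_functional_on_ip_comp[OF face_L2[OF e]])
      (auto simp: face_closed[OF e] intro: snd_V_continuous e PolM_times_vector_continuous[OF G])
  have 3: "linear_functional_on (V_loc k \<E> T)
     (\<lambda>v. ip (surf e) e (\<lambda>x. fst v x - snd v e x) (boundary_defect w e))"
    if e: "e \<in> faces \<E> T" for e
    by (rule L2_domain.linear_functional_on_ip_comp[OF face_L2[OF e]])
      (auto simp: face_closed[OF e] algebra_simps
        intro!: continuous_intros snd_V_continuous fst_V_continuous e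
          PolF_continuous[OF boundary_defect_PolF[OF w e]])
  have "linear_functional_on (V_loc k \<E> T) (\<lambda>v.
      - ip lebesgue T (fst v) (row_div (weak_grad k \<E> T w))
      + (\<Sum>e\<in>faces \<E> T. ip (surf e) e (snd v e) (\<lambda>x. weak_grad k \<E> T w x *v normal T e))
      + inverse (diameter T) *
        (\<Sum>e\<in>faces \<E> T. ip (surf e) e (\<lambda>x. fst v x - snd v e x) (boundary_defect w e)))"
    by (intro linear_functional_on_add linear_functional_on_minus linear_functional_on_cmult
        linear_functional_on_sum 1 2 3)
  then show ?thesis
    using subspace_V_loc[of k \<E> T]
    by (simp add: linear_functional_on_def a_loc_eq w subspace_add subspace_scale)
qed

sublocale a: semi_inner_product "V_loc k \<E> T" "a_loc k \<E> T"
proof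
  show "0 \<le> a_loc k \<E> T v v" for v
    unfolding a_loc_def
    by (intro add_nonneg_nonneg mult_nonneg_nonneg sum_nonneg ip_nonneg)
      (simp add: diameter_ge_0 cell.S_bounded)
  show "a_loc k \<E> T v w = a_loc k \<E> T w v" for v w
    unfolding a_loc_def by (simp add: ip_commute)
qed (rule subspace_V_loc, rule linear_functional_on_a_loc)

text \<open>The pressure is polynomial only inside the cell; testing the weak divergence with the polynomial
  \<open>p'\<close> gives an expression that is linear in \<open>v\<close>.\<close>

lemma linear_functional_on_b_loc:
  assumes "p' \<in> Pol (k - 1)" "\<forall>x\<in>T. p x = p' x"
  shows "linear_functional_on (V_loc k \<E> T) (\<lambda>v. b_loc k \<E> T v p)"
proof -
  have b: "b_loc k \<E> T v p = - ip lebesgue T (fst v) (grad p')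
      + (\<Sum>e\<in>faces \<E> T. ip (surf e) e (\<lambda>x. snd v e x \<bullet> normal T e) p')"
    if "v \<in> V_loc k \<E> T" for v
  proof -
    have "b_loc k \<E> T v p = ip lebesgue T (weak_div k \<E> T v) p'"
      unfolding b_loc_def by (rule ip_cong) (use assms in auto)
    then show ?thesis using weak_div_properties[OF that] assms(1) by simp
  qed
  have "linear_functional_on (V_loc k \<E> T) (\<lambda>v. ip (surf e) e (\<lambda>x. snd v e x \<bullet> normal T e) p')"
    if e: "e \<in> faces \<E> T" for e
    by (rule L2_domain.linear_functional_on_ip_comp[OF face_L2[OF e]])
      (auto simp: face_closed[OF e] inner_add_left
        intro: continuous_on_inner[OF snd_V_continuous[OF _ e] continuous_on_const]
          Pol_continuous[OF assms(1)])
  then have "linear_functional_on (V_loc k \<E> T) (\<lambda>v. - ip lebesgue T (fst v) (grad p')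
      + (\<Sum>e\<in>faces \<E> T. ip (surf e) e (\<lambda>x. snd v e x \<bullet> normal T e) p'))"
    by (intro linear_functional_on_add linear_functional_on_minus linear_functional_on_sum
        linear_functional_on_ip_fst grad_continuous[OF assms(1)])
  then show ?thesis
    using subspace_V_loc[of k \<E> T]
    by (simp add: linear_functional_on_def b subspace_add subspace_scale)
qed

section \<open>The local problems and the boundary flux\<close>

text \<open>Face fields carry arbitrary values at sets that are not faces of the cell. The following
  congruences say that the forms do not see these values.\<close>

lemma weak_grad_cong:
  assumes "\<And>e. e \<in> faces \<E> T \<Longrightarrow> vb e = vb' e"
  shows "weak_grad k \<E> T (v0, vb) = weak_grad k \<E> T (v0, vb')"
  unfolding weak_grad_def using assms by (simp cong: sum.cong)

lemma weak_div_cong: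
  assumes "\<And>e. e \<in> faces \<E> T \<Longrightarrow> vb e = vb' e"
  shows "weak_div k \<E> T (v0, vb) = weak_div k \<E> T (v0, vb')"
  unfolding weak_div_def using assms by (simp cong: sum.cong)

lemma a_loc_cong:
  assumes "\<And>e. e \<in> faces \<E> T \<Longrightarrow> vb e = vb' e"
  shows "a_loc k \<E> T (v0, vb) w = a_loc k \<E> T (v0, vb') w"
proof -
  have "weak_grad k \<E> T (v0, vb) = weak_grad k \<E> T (v0, vb')" by (rule weak_grad_cong[OF assms])
  then show ?thesis using assms by (simp add: a_loc_def cong: sum.cong)
qed

lemma b_loc_cong:
  assumes "\<And>e. e \<in> faces \<E> T \<Longrightarrow> vb e = vb' e"
  shows "b_loc k \<E> T (v0, vb) p = b_loc k \<E> T (v0, vb') p"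
proof -
  have "weak_div k \<E> T (v0, vb) = weak_div k \<E> T (v0, vb')" by (rule weak_div_cong[OF assms])
  then show ?thesis by (simp add: b_loc_def)
qed

lemma PolF_zero_if_null:
  assumes e: "e \<in> faces \<E> T" and v: "v \<in> PolF r e" and null: "ip (surf e) e v v = 0"
  shows "v = (\<lambda>x. 0)"
proof
  fix x
  interpret face: L2_domain "surf e" e by (rule face_L2[OF e])
  show "v x = 0"
  proof (cases "x \<in> e")
    case True
    then show ?thesis
      using face.ip_self_eq_0[OF _ null] PolF_continuous[OF v] by (simp add: face_closed[OF e])
  qed (rule PolF_outside[OF v])
qed

text \<open>The face fields with their irrelevant values do not form a finitely spanned space. The
  functional is therefore represented on each face separately, by feeding it the fields supported
  on that face; a field agrees on the faces with the sum of its single-face parts.\<close>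

lemma boundary_riesz:
  assumes l: "linear_functional_on (Lambda_loc k \<E> T) l"
    and cong: "\<And>vb vb'. (\<And>e. e \<in> faces \<E> T \<Longrightarrow> vb e = vb' e) \<Longrightarrow> l vb = l vb'"
  shows "\<exists>\<zeta>\<in>Lambda_loc k \<E> T. \<forall>vb\<in>Lambda_loc k \<E> T.
    (\<Sum>e\<in>faces \<E> T. ip (surf e) e (vb e) (\<zeta> e)) = l vb"
proof -
  define single :: "(real^'d) set \<Rightarrow> 'd vfield \<Rightarrow> 'd ffield" where
    "single e w = (\<lambda>e'. if e' = e then w else 0)" for e w
  have zero: "0 \<in> PolF (k - 1) e" for e :: "(real^'d) set"
    by (rule subspace_0[OF finitely_spanned_subspace[OF finitely_spanned_PolF]])
  have single: "single e w \<in> Lambda_loc k \<E> T" if "w \<in> PolF (k - 1) e" for e w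
    using that zero by (auto simp: single_def Lambda_loc_def)
  have "\<exists>z\<in>PolF (k - 1) e. \<forall>w\<in>PolF (k - 1) e. ip (surf e) e z w = l (single e w)"
    if e: "e \<in> faces \<E> T" for e
  proof -
    interpret face: L2_domain "surf e" e by (rule face_L2[OF e])
    show ?thesis
    proof (rule face.riesz_continuous[OF finitely_spanned_PolF])
      show "PolF (k - 1) e \<subseteq> face.continuous_functions"
        by (auto simp: face_closed[OF e] intro: PolF_continuous)
      have "single e (v + w) = single e v + single e w" "single e (c *\<^sub>R v) = c *\<^sub>R single e v" for v w c
        by (auto simp: single_def fun_eq_iff)
      then show "linear_functional_on (PolF (k - 1) e) (\<lambda>w. l (single e w))"
        using l single by (simp add: linear_functional_on_def)
      show "l (single e w) = 0" if w: "w \<in> PolF (k - 1) e" and null: "\<And>x. x \<in> closure e \<Longrightarrow> w x = 0" for w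
      proof -
        have "w x = 0" for x
          using null[of x] PolF_outside[OF w, of x] by (cases "x \<in> e") (auto simp: face_closed[OF e])
        then have "single e w = 0" by (auto simp: single_def fun_eq_iff)
        then show ?thesis
          using linear_functional_on_zero[OF l subspace_0[OF subspace_Lambda_loc]] by simp
      qed
    qed
  qed
  then obtain \<zeta> where z: "\<And>e. e \<in> faces \<E> T \<Longrightarrow> \<zeta> e \<in> PolF (k - 1) e"
    "\<And>e w. e \<in> faces \<E> T \<Longrightarrow> w \<in> PolF (k - 1) e \<Longrightarrow> ip (surf e) e (\<zeta> e) w = l (single e w)"
    by metis
  show ?thesis
  proof (intro bexI ballI)
    show "\<zeta> \<in> Lambda_loc k \<E> T" using z(1) by (auto simp: Lambda_loc_def)
    fix vb assume "vb \<in> Lambda_loc k \<E> T"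
    then have vb: "vb e \<in> PolF (k - 1) e" if "e \<in> faces \<E> T" for e
      using that by (auto simp: Lambda_loc_def)
    have eval: "(\<Sum>e\<in>A. single e (vb e)) e' = (if e' \<in> A then vb e' else 0)" if "finite A" for A e'
      using that by (induction A) (auto simp: single_def)
    have "l vb = l (\<Sum>e\<in>faces \<E> T. single e (vb e))"
      by (rule cong) (simp add: eval finite_faces)
    also have "\<dots> = (\<Sum>e\<in>faces \<E> T. l (single e (vb e)))"
      by (rule linear_functional_on_image_sum[OF l subspace_Lambda_loc finite_faces])
        (rule single[OF vb])
    also have "\<dots> = (\<Sum>e\<in>faces \<E> T. ip (surf e) e (vb e) (\<zeta> e))"
      using z(2)[OF _ vb] by (intro sum.cong refl) (simp only: ip_commute)
    finally show "(\<Sum>e\<in>faces \<E> T. ip (surf e) e (vb e) (\<zeta> e)) = l vb" ..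
  qed
qed

lemma interior_part_in_V_loc: "v0 \<in> PolV k \<Longrightarrow> (v0, \<lambda>e x. 0) \<in> V_loc k \<E> T"
  using subspace_0[OF subspace_Lambda_loc, of k \<E> T]
  by (simp add: V_loc_def zero_fun_def)

lemma boundary_part_in_V_loc: "vb \<in> Lambda_loc k \<E> T \<Longrightarrow> (\<lambda>x. 0, vb) \<in> V_loc k \<E> T"
  using subspace_0[OF finitely_spanned_subspace[OF finitely_spanned_PolV], of k]
  by (simp add: V_loc_def zero_fun_def)

text \<open>The difference \<open>d\<close> of two local solutions has zero boundary part, hence is itself an admissible
  test function, and \<open>a\<^sub>T d d = 0\<close>. Null vectors are orthogonal to everything, so the two
  solutions give the same form.\<close>

lemma a_loc_local_solution_unique:
  assumes wb: "wb \<in> Lambda_loc k \<E> T"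
    and w: "local_solution k \<E> T f wb p w" and w': "local_solution k \<E> T f wb p w'"
    and z: "z \<in> V_loc k \<E> T"
  shows "a_loc k \<E> T (w, wb) z = a_loc k \<E> T (w', wb) z"
proof -
  have wV: "(w, wb) \<in> V_loc k \<E> T" "(w', wb) \<in> V_loc k \<E> T"
    using w w' wb by (auto simp: local_solution_def V_loc_def)
  define d where "d = (w, wb) - (w', wb)"
  have d: "d = (w - w', \<lambda>e x. 0)" by (simp add: d_def fun_eq_iff)
  have dV: "d \<in> V_loc k \<E> T" unfolding d_def by (rule subspace_diff[OF subspace_V_loc wV])
  then have "w - w' \<in> PolV k" by (simp add: d V_loc_def)
  then have "a_loc k \<E> T (w, wb) d = a_loc k \<E> T (w', wb) d"
    using w w' unfolding d local_solution_def by (metis diff_add_cancel)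
  moreover have "a_loc k \<E> T d d = a_loc k \<E> T (w, wb) d - a_loc k \<E> T (w', wb) d"
    unfolding d_def by (rule a.diff_left[OF wV dV[unfolded d_def]])
  ultimately have "a_loc k \<E> T d d = 0" by (simp only: diff_self)
  then have "a_loc k \<E> T d z = 0" by (rule a.null_left[OF dV z])
  then show ?thesis unfolding d_def a.diff_left[OF wV z] by (simp only: right_minus_eq)
qed

text \<open>The flux is defined from the chosen local solution, but any local solution \<open>w0\<close> may be put in its
  place. It exists because the right-hand side is a functional of the face values.\<close>

lemma zeta_properties:
  assumes wb: "wb \<in> Lambda_loc k \<E> T" and w: "local_solution k \<E> T f wb p w0"
    and p: "p' \<in> Pol (k - 1)" "\<forall>x\<in>T. p x = p' x"
  shows "zeta k \<E> f wb p T \<in> Lambda_loc k \<E> T \<and> (\<forall>vb\<in>Lambda_loc k \<E> T.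
     c_loc \<E> T (\<lambda>x. 0, vb) (zeta k \<E> f wb p T)
       = a_loc k \<E> T (w0, wb) (\<lambda>x. 0, vb) - b_loc k \<E> T (\<lambda>x. 0, vb) p)"
proof -
  define w where "w = D_op k \<E> T f wb p"
  have w': "local_solution k \<E> T f wb p w"
    unfolding w_def D_op_def by (rule someI[where P = "local_solution k \<E> T f wb p", OF w])
  have wV: "(w, wb) \<in> V_loc k \<E> T" using w' wb by (simp add: local_solution_def V_loc_def)
  define l where "l vb = a_loc k \<E> T (w, wb) (\<lambda>x. 0, vb) - b_loc k \<E> T (\<lambda>x. 0, vb) p" for vb
  have l_alt: "l vb = a_loc k \<E> T (\<lambda>x. 0, vb) (w, wb) + - b_loc k \<E> T (\<lambda>x. 0, vb) p" for vb
    by (simp add: l_def a_loc_def ip_commute)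
  have V: "linear_functional_on (V_loc k \<E> T) (\<lambda>v. a_loc k \<E> T v (w, wb) + - b_loc k \<E> T v p)"
    by (intro linear_functional_on_add linear_functional_on_minus linear_functional_on_a_loc wV
        linear_functional_on_b_loc[OF p])
  have "linear_functional_on (Lambda_loc k \<E> T) l"
    unfolding linear_functional_on_def
  proof (intro conjI ballI allI)
    fix v v' assume v: "v \<in> Lambda_loc k \<E> T" "v' \<in> Lambda_loc k \<E> T"
    have "((\<lambda>x. 0, v + v') :: 'd weakfun) = (\<lambda>x. 0, v) + (\<lambda>x. 0, v')"
      by (simp add: fun_eq_iff)
    then show "l (v + v') = l v + l v'"
      using V boundary_part_in_V_loc[OF v(1)] boundary_part_in_V_loc[OF v(2)]
      unfolding linear_functional_on_def l_alt by metis
  next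
    fix c v assume v: "v \<in> Lambda_loc k \<E> T"
    have "((\<lambda>x. 0, c *\<^sub>R v) :: 'd weakfun) = c *\<^sub>R (\<lambda>x. 0, v)"
      by (simp add: fun_eq_iff)
    then show "l (c *\<^sub>R v) = c * l v"
      using V boundary_part_in_V_loc[OF v] unfolding linear_functional_on_def l_alt by metis
  qed
  moreover have "l vb = l vb'" if "\<And>e. e \<in> faces \<E> T \<Longrightarrow> vb e = vb' e" for vb vb'
  proof -
    have "a_loc k \<E> T (\<lambda>x. 0, vb) (w, wb) = a_loc k \<E> T (\<lambda>x. 0, vb') (w, wb)"
      by (rule a_loc_cong[OF that])
    moreover have "b_loc k \<E> T (\<lambda>x. 0, vb) p = b_loc k \<E> T (\<lambda>x. 0, vb') p"
      by (rule b_loc_cong[OF that])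
    ultimately show ?thesis by (simp only: l_alt)
  qed
  ultimately have ex: "\<exists>\<zeta>. \<zeta> \<in> Lambda_loc k \<E> T \<and> (\<forall>vb\<in>Lambda_loc k \<E> T.
      c_loc \<E> T (\<lambda>x. 0, vb) \<zeta> = l vb)"
    using boundary_riesz unfolding c_loc_def snd_conv by blast
  have "zeta k \<E> f wb p T \<in> Lambda_loc k \<E> T \<and> (\<forall>vb\<in>Lambda_loc k \<E> T.
      c_loc \<E> T (\<lambda>x. 0, vb) (zeta k \<E> f wb p T) = l vb)"
    using someI_ex[OF ex] unfolding zeta_def l_def w_def .
  moreover have "l vb = a_loc k \<E> T (w0, wb) (\<lambda>x. 0, vb) - b_loc k \<E> T (\<lambda>x. 0, vb) p"
    if "vb \<in> Lambda_loc k \<E> T" for vb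
    using a_loc_local_solution_unique[OF wb w' w boundary_part_in_V_loc[OF that]] by (simp add: l_def)
  ultimately show ?thesis by simp
qed

text \<open>Interior test functions \<open>{v\<^sub>0, 0}\<close> are taken care of by the local problem and
  boundary test functions \<open>{0, v\<^sub>b}\<close> by the flux; every weak function is the sum of two such
  functions.\<close>

lemma residual_eq_c_loc:
  assumes wb: "wb \<in> Lambda_loc k \<E> T" and w: "local_solution k \<E> T f wb p w0"
    and p: "p' \<in> Pol (k - 1)" "\<forall>x\<in>T. p x = p' x" and v: "v \<in> V_loc k \<E> T"
  shows "a_loc k \<E> T (w0, wb) v - b_loc k \<E> T v p
    = ip lebesgue T f (fst v) + c_loc \<E> T v (zeta k \<E> f wb p T)"
proof -
  obtain v0 vb where v': "v = (v0, vb)" "v0 \<in> PolV k" "vb \<in> Lambda_loc k \<E> T"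
    using v by (auto simp: V_loc_def)
  have split: "v = (v0, \<lambda>e x. 0) + (\<lambda>x. 0, vb)" by (simp add: v' fun_eq_iff)
  have wV: "(w0, wb) \<in> V_loc k \<E> T" using w wb by (simp add: local_solution_def V_loc_def)
  note mem = interior_part_in_V_loc[OF v'(2)] boundary_part_in_V_loc[OF v'(3)]
  have "a_loc k \<E> T (w0, wb) v = a_loc k \<E> T (w0, wb) (v0, \<lambda>e x. 0) + a_loc k \<E> T (w0, wb) (\<lambda>x. 0, vb)"
    unfolding split by (rule a.add_right[OF mem wV])
  moreover have "b_loc k \<E> T v p = b_loc k \<E> T (v0, \<lambda>e x. 0) p + b_loc k \<E> T (\<lambda>x. 0, vb) p"
    unfolding split using linear_functional_on_b_loc[OF p] mem by (simp only: linear_functional_on_def)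
  moreover have "a_loc k \<E> T (w0, wb) (v0, \<lambda>e x. 0) - b_loc k \<E> T (v0, \<lambda>e x. 0) p = ip lebesgue T f v0"
    using w v'(2) by (simp add: local_solution_def)
  moreover have "c_loc \<E> T v (zeta k \<E> f wb p T)
      = a_loc k \<E> T (w0, wb) (\<lambda>x. 0, vb) - b_loc k \<E> T (\<lambda>x. 0, vb) p"
    using zeta_properties[OF wb w p] v'(3) by (simp add: c_loc_def v'(1))
  ultimately show ?thesis by (simp add: v'(1))
qed

end

section \<open>Assembling the fluxes over the mesh\<close>

lemma mesh_cellI: "mesh \<Omega> \<T> \<E> \<Longrightarrow> T \<in> \<T> \<Longrightarrow> mesh_cell \<E> T"
  by unfold_locales (auto simp: mesh_def faces_def)

text \<open>Exchanging the sums over cells and faces collects, on each interior face, the fluxes of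
  the adjacent cells against the common value \<open>y e\<close> of the test function; on boundary faces the
  test function vanishes.\<close>

lemma sum_c_loc_eq_similarity:
  assumes mesh: "mesh \<Omega> \<T> \<E>" and v: "v \<in> Vh_cont0 k \<Omega> \<T> \<E>"
    and z: "\<And>T. T \<in> \<T> \<Longrightarrow> z T \<in> Lambda_loc k \<E> T"
    and y: "\<And>e T. e \<in> interior_faces \<Omega> \<E> \<Longrightarrow> T \<in> cells_at \<T> e \<Longrightarrow> snd (v T) e = y e"
  shows "(\<Sum>T\<in>\<T>. c_loc \<E> T (v T) (z T))
    = (\<Sum>e\<in>interior_faces \<Omega> \<E>. ip (surf e) e (y e) (similarity \<Omega> \<T> \<E> z e))"
proof -
  have fin: "finite \<T>" "finite \<E>" using mesh by (auto simp: mesh_def)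
  have "(\<Sum>T\<in>\<T>. c_loc \<E> T (v T) (z T))
      = (\<Sum>T\<in>\<T>. \<Sum>e\<in>\<E>. if e \<subseteq> frontier T then ip (surf e) e (snd (v T) e) (z T e) else 0)"
    unfolding c_loc_def faces_def using fin by (simp add: sum.inter_filter)
  also have "\<dots> = (\<Sum>e\<in>\<E>. \<Sum>T\<in>\<T>. if e \<subseteq> frontier T then ip (surf e) e (snd (v T) e) (z T e) else 0)"
    by (rule sum.swap)
  also have "\<dots> = (\<Sum>e\<in>\<E>. \<Sum>T\<in>cells_at \<T> e. ip (surf e) e (snd (v T) e) (z T e))"
    unfolding cells_at_def using fin by (simp add: sum.inter_filter)
  also have "\<dots> = (\<Sum>e\<in>interior_faces \<Omega> \<E>. \<Sum>T\<in>cells_at \<T> e. ip (surf e) e (snd (v T) e) (z T e))"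
  proof (rule sum.mono_neutral_right[OF fin(2)])
    show "interior_faces \<Omega> \<E> \<subseteq> \<E>" by (auto simp: interior_faces_def)
    show "\<forall>e\<in>\<E> - interior_faces \<Omega> \<E>. (\<Sum>T\<in>cells_at \<T> e. ip (surf e) e (snd (v T) e) (z T e)) = 0"
      using v by (auto simp: interior_faces_def Vh_cont0_def intro!: sum.neutral ip_zero_left)
  qed
  also have "\<dots> = (\<Sum>e\<in>interior_faces \<Omega> \<E>. ip (surf e) e (y e) (similarity \<Omega> \<T> \<E> z e))"
  proof (rule sum.cong[OF refl])
    fix e assume e: "e \<in> interior_faces \<Omega> \<E>"
    have cont: "z T e \<in> {f. continuous_on (closure e) f}" "snd (v T) e \<in> {f. continuous_on (closure e) f}"
      and eL2: "L2_domain (surf e) e" if "T \<in> cells_at \<T> e" for T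
    proof -
      have T: "T \<in> \<T>" "e \<in> faces \<E> T"
        using that e by (auto simp: cells_at_def faces_def interior_faces_def)
      interpret mesh_cell k \<E> T by (rule mesh_cellI[OF mesh T(1)])
      show "L2_domain (surf e) e" by (rule face_L2[OF T(2)])
      have "z T e \<in> PolF (k - 1) e" using z[OF T(1)] T(2) by (auto simp: Lambda_loc_def)
      then show "z T e \<in> {f. continuous_on (closure e) f}"
        by (simp add: face_closed[OF T(2)] PolF_continuous)
      have "v T \<in> V_loc k \<E> T" using v T(1) by (auto simp: Vh_cont0_def Vh_cont_def Vh_def)
      from snd_V_continuous[OF this T(2)] show "snd (v T) e \<in> {f. continuous_on (closure e) f}"
        by (simp add: face_closed[OF T(2)])
    qed
    have "card (cells_at \<T> e) = 2" using mesh e by (simp add: mesh_def)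
    then obtain T0 where T0: "T0 \<in> cells_at \<T> e" by fastforce
    interpret face: L2_domain "surf e" e by (rule eL2[OF T0])
    have y_cont: "y e \<in> face.continuous_functions" using cont(2)[OF T0] y[OF e T0] by simp
    have fin_e: "finite (cells_at \<T> e)" using fin by (simp add: cells_at_def)
    have "(\<Sum>T\<in>cells_at \<T> e. ip (surf e) e (snd (v T) e) (z T e))
        = (\<Sum>T\<in>cells_at \<T> e. ip (surf e) e (z T e) (y e))"
      by (intro sum.cong refl) (simp add: y[OF e] ip_commute)
    also have "\<dots> = ip (surf e) e (\<Sum>T\<in>cells_at \<T> e. z T e) (y e)"
      by (rule linear_functional_on_image_sum[OF face.linear[OF y_cont] face.subspace fin_e cont(1), symmetric])
    also have "(\<Sum>T\<in>cells_at \<T> e. z T e) = similarity \<Omega> \<T> \<E> z e"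
    proof
      have *: "(\<Sum>T\<in>A. z T e) x = (\<Sum>T\<in>A. z T e x)" for A x
        by (induction A rule: infinite_finite_induct) auto
      show "(\<Sum>T\<in>cells_at \<T> e. z T e) x = similarity \<Omega> \<T> \<E> z e x" for x
        using e by (simp add: * similarity_def)
    qed
    finally show "(\<Sum>T\<in>cells_at \<T> e. ip (surf e) e (snd (v T) e) (z T e))
        = ip (surf e) e (y e) (similarity \<Omega> \<T> \<E> z e)" by (simp add: ip_commute)
  qed
  finally show ?thesis .
qed

lemma similarity_in_PolF:
  assumes "\<And>T. T \<in> \<T> \<Longrightarrow> z T \<in> Lambda_loc k \<E> T" and e: "e \<in> \<E>"
  shows "similarity \<Omega> \<T> \<E> z e \<in> PolF (k - 1) e"
proof -
  have sub: "subspace (PolF (k - 1) e)"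
    by (rule finitely_spanned_subspace[OF finitely_spanned_PolF])
  have *: "(\<Sum>T\<in>A. z T e) x = (\<Sum>T\<in>A. z T e x)" for A x
    by (induction A rule: infinite_finite_induct) auto
  have "similarity \<Omega> \<T> \<E> z e = (if e \<in> interior_faces \<Omega> \<E> then \<Sum>T\<in>cells_at \<T> e. z T e else 0)"
    by (auto simp: similarity_def * fun_eq_iff)
  moreover have "(\<Sum>T\<in>cells_at \<T> e. z T e) \<in> PolF (k - 1) e"
    using assms by (intro subspace_sum[OF sub]) (auto simp: Lambda_loc_def cells_at_def faces_def)
  ultimately show ?thesis using subspace_0[OF sub] by simp
qed

lemma boundary_function_in_Vh_cont0:
  assumes "\<And>e. e \<in> \<E> \<Longrightarrow> s e \<in> PolF (k - 1) e" "\<And>e. e \<in> boundary_faces \<Omega> \<E> \<Longrightarrow> s e = (\<lambda>x. 0)"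
  shows "(\<lambda>T. (\<lambda>x. 0, s)) \<in> Vh_cont0 k \<Omega> \<T> \<E>"
proof -
  have "(\<lambda>x. 0) \<in> PolV k"
    using subspace_0[OF finitely_spanned_subspace[OF finitely_spanned_PolV], of k] by (simp add: zero_fun_def)
  then show ?thesis
    using assms by (auto simp: Vh_cont0_def Vh_cont_def Vh_def V_loc_def Lambda_loc_def faces_def jump_def)
qed

text \<open>If all the sums vanish, the similarity itself can serve as test function, since it is zero on
  the boundary faces; then its norm on every interior face vanishes, and definiteness on the
  face turns this into a pointwise statement.\<close>

lemma similarity_zero_iff:
  assumes mesh: "mesh \<Omega> \<T> \<E>" and z: "\<And>T. T \<in> \<T> \<Longrightarrow> z T \<in> Lambda_loc k \<E> T"
  shows "(\<forall>v\<in>Vh_cont0 k \<Omega> \<T> \<E>. (\<Sum>T\<in>\<T>. c_loc \<E> T (v T) (z T)) = 0)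
    \<longleftrightarrow> similarity \<Omega> \<T> \<E> z = (\<lambda>e x. 0)"
proof
  assume test: "\<forall>v\<in>Vh_cont0 k \<Omega> \<T> \<E>. (\<Sum>T\<in>\<T>. c_loc \<E> T (v T) (z T)) = 0"
  define s where "s = similarity \<Omega> \<T> \<E> z"
  have s: "s e \<in> PolF (k - 1) e" if "e \<in> \<E>" for e
    unfolding s_def by (rule similarity_in_PolF[OF z that])
  have v: "(\<lambda>T. (\<lambda>x. 0, s)) \<in> Vh_cont0 k \<Omega> \<T> \<E>"
    by (rule boundary_function_in_Vh_cont0[OF s])
      (auto simp: s_def similarity_def interior_faces_def fun_eq_iff)
  have "(\<Sum>e\<in>interior_faces \<Omega> \<E>. ip (surf e) e (s e) (s e)) = 0"
    using test v sum_c_loc_eq_similarity[OF mesh v z, of s] by (simp add: s_def)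
  moreover have fin: "finite (interior_faces \<Omega> \<E>)"
    using mesh by (simp add: mesh_def interior_faces_def)
  ultimately have null: "ip (surf e) e (s e) (s e) = 0" if "e \<in> interior_faces \<Omega> \<E>" for e
    using that by (simp add: sum_nonneg_eq_0_iff ip_nonneg)
  have "s e = (\<lambda>x. 0)" for e
  proof (cases "e \<in> interior_faces \<Omega> \<E>")
    case True
    then have "card (cells_at \<T> e) = 2" using mesh by (simp add: mesh_def)
    then obtain T where "T \<in> cells_at \<T> e" by fastforce
    with True have T: "T \<in> \<T>" "e \<in> faces \<E> T" "e \<in> \<E>"
      by (auto simp: cells_at_def faces_def interior_faces_def)
    interpret mesh_cell k \<E> T by (rule mesh_cellI[OF mesh T(1)])
    show ?thesis by (rule PolF_zero_if_null[OF T(2) s[OF T(3)] null[OF True]])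
  qed (simp add: s_def similarity_def)
  then show "similarity \<Omega> \<T> \<E> z = (\<lambda>e x. 0)" by (simp add: s_def fun_eq_iff)
next
  assume zero: "similarity \<Omega> \<T> \<E> z = (\<lambda>e x. 0)"
  show "\<forall>v\<in>Vh_cont0 k \<Omega> \<T> \<E>. (\<Sum>T\<in>\<T>. c_loc \<E> T (v T) (z T)) = 0"
  proof
    fix v assume v: "v \<in> Vh_cont0 k \<Omega> \<T> \<E>"
    \<comment> \<open>A vanishing jump makes the value on an interior face independent of the adjacent cell.\<close>
    define y where "y e = snd (v (SOME T. T \<in> cells_at \<T> e)) e" for e
    have "snd (v T) e = y e" if e: "e \<in> interior_faces \<Omega> \<E>" and T: "T \<in> cells_at \<T> e" for e T
    proof -
      define T' where "T' = (SOME T. T \<in> cells_at \<T> e)"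
      have "T' \<in> cells_at \<T> e" unfolding T'_def using T by (rule someI)
      then have "T = T' \<or> jump v T T' e = (\<lambda>x. 0)"
        using v e T by (auto simp: Vh_cont0_def Vh_cont_def)
      then show ?thesis by (auto simp: y_def jump_def fun_eq_iff simp flip: T'_def)
    qed
    from sum_c_loc_eq_similarity[OF mesh v z this]
    show "(\<Sum>T\<in>\<T>. c_loc \<E> T (v T) (z T)) = 0" by (simp add: zero ip_zero_right)
  qed
qed

section \<open>The equivalence\<close>

theorem theorem7p4:
  fixes \<Omega> :: "(real^'d) set"
    and \<T> \<E> :: "(real^'d) set set"
    and f g :: "real^'d \<Rightarrow> real^'d"
    and k N :: nat
    and \<rho>v \<rho>e \<kappa> \<sigma>s \<theta>0 \<gamma>s \<rho>s :: real
    and p\<^sub>h :: "real^'d \<Rightarrow> real"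
    and u\<^sub>b :: "(real^'d) set \<Rightarrow> real^'d \<Rightarrow> real^'d"
    and u\<^sub>0 :: "(real^'d) set \<Rightarrow> real^'d \<Rightarrow> real^'d"
  assumes "CARD('d) \<in> {2, 3}"
    and "polyhedral_domain \<Omega>"
    and "mesh \<Omega> \<T> \<E>"
    and "shape_regular \<T> \<E> \<rho>v \<rho>e \<kappa> \<sigma>s \<theta>0 \<gamma>s \<rho>s N"
    and "k \<ge> 1"
    and "square_integrable lebesgue \<Omega> f"
    and "\<forall>e\<in>boundary_faces \<Omega> \<E>. square_integrable (surf e) e g"
    and "p\<^sub>h \<in> Wh k \<Omega> \<T>"
    and "u\<^sub>b \<in> Bh k \<E>"
    and "\<forall>e\<in>boundary_faces \<Omega> \<E>. u\<^sub>b e = Qb k e g"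
    and "\<forall>T\<in>\<T>. local_solution k \<E> T f u\<^sub>b p\<^sub>h (u\<^sub>0 T)"
  shows "wg_solution k \<Omega> \<T> \<E> f g (\<lambda>T. (u\<^sub>0 T, u\<^sub>b)) p\<^sub>h \<longleftrightarrow>
     S_op k \<Omega> \<T> \<E> f u\<^sub>b p\<^sub>h = (\<lambda>e x. 0) \<and>
     (\<forall>q\<in>Wh k \<Omega> \<T>. b_form k \<T> \<E> (\<lambda>T. (u\<^sub>0 T, u\<^sub>b)) q = 0)"
proof -
  note mesh = assms(3) and p = assms(8) and ub = assms(9) and bc = assms(10) and loc = assms(11)
  let ?z = "zeta k \<E> f u\<^sub>b p\<^sub>h" and ?u = "\<lambda>T. (u\<^sub>0 T, u\<^sub>b)"
  have ub_loc: "u\<^sub>b \<in> Lambda_loc k \<E> T" for T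
    using ub by (auto simp: Bh_def Lambda_loc_def faces_def)
  have p_pol: "\<exists>p'\<in>Pol (k - 1). \<forall>x\<in>T. p\<^sub>h x = p' x" if "T \<in> \<T>" for T
    using p that by (simp add: Wh_def)
  have z: "?z T \<in> Lambda_loc k \<E> T" if T: "T \<in> \<T>" for T
  proof -
    interpret mesh_cell k \<E> T by (rule mesh_cellI[OF mesh T])
    show ?thesis using zeta_properties[OF ub_loc] loc T p_pol[OF T] by blast
  qed
  have u: "?u \<in> Vh_cont k \<Omega> \<T> \<E>"
    using loc ub_loc by (auto simp: Vh_cont_def Vh_def V_loc_def local_solution_def jump_def)
  have residual: "a_form k \<T> \<E> ?u v - b_form k \<T> \<E> v p\<^sub>h
      = (\<Sum>T\<in>\<T>. ip lebesgue T f (fst (v T))) + (\<Sum>T\<in>\<T>. c_loc \<E> T (v T) (?z T))"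
    if v: "v \<in> Vh_cont0 k \<Omega> \<T> \<E>" for v
  proof -
    have "a_loc k \<E> T (u\<^sub>0 T, u\<^sub>b) (v T) - b_loc k \<E> T (v T) p\<^sub>h
        = ip lebesgue T f (fst (v T)) + c_loc \<E> T (v T) (?z T)" if T: "T \<in> \<T>" for T
    proof -
      interpret mesh_cell k \<E> T by (rule mesh_cellI[OF mesh T])
      have "v T \<in> V_loc k \<E> T" using v T by (auto simp: Vh_cont0_def Vh_cont_def Vh_def)
      then show ?thesis using residual_eq_c_loc[OF ub_loc] loc T p_pol[OF T] by blast
    qed
    then show ?thesis
      by (simp add: a_form_def b_form_def flip: sum_subtractf sum.distrib)
  qed
  have S_zero: "(\<forall>v\<in>Vh_cont0 k \<Omega> \<T> \<E>. (\<Sum>T\<in>\<T>. c_loc \<E> T (v T) (?z T)) = 0)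
      \<longleftrightarrow> S_op k \<Omega> \<T> \<E> f u\<^sub>b p\<^sub>h = (\<lambda>e x. 0)"
    unfolding S_op_def by (rule similarity_zero_iff[OF mesh z])
  have "wg_solution k \<Omega> \<T> \<E> f g ?u p\<^sub>h \<longleftrightarrow>
      (\<forall>v\<in>Vh_cont0 k \<Omega> \<T> \<E>. (\<Sum>T\<in>\<T>. c_loc \<E> T (v T) (?z T)) = 0) \<and>
      (\<forall>q\<in>Wh k \<Omega> \<T>. b_form k \<T> \<E> ?u q = 0)"
    using u p bc by (simp add: wg_solution_def residual)
  also have "\<dots> \<longleftrightarrow> S_op k \<Omega> \<T> \<E> f u\<^sub>b p\<^sub>h = (\<lambda>e x. 0) \<and>
      (\<forall>q\<in>Wh k \<Omega> \<T>. b_form k \<T> \<E> ?u q = 0)"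
    using S_zero by blast
  finally show ?thesis .
qed

end
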